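(* Let $A$ be a reversible $JW$-algebra acting on a Hilbert space $H$, with a faithful normal state $\rho$. Let $\{x_n\}\subset A$ be a sequence of pairwise uncorrelated operators (i.e. $\mathrm{cov}(x_m,x_n)=0$ for $m\neq n$) such that (i) $x_n$ is bundle convergent in $A$ to some $x\in A$, and (ii) $\sum_{n=1}^\infty n^{-2}\,\mathrm{var}(x_n)\log^2(n+1)<\infty$. Then there exists a complex number $c$ such that $x=c{\bf 1}$, where ${\bf 1}$ is the identity of $A$.
   Context: A $JW$-algebra is a real linear space of self-adjoint operators in $B(H)$ ($H$ a complex Hilbert space), containing the identity ${\bf 1}$, closed under the Jordan product $a\circ b=\frac12(ab+ba)$ and closed in the weak operator topology; it is reversible if $a_1a_2\cdots a_n+a_na_{n-1}\cdots a_1\in A$ whenever $a_1,\dots,a_n\in A$. Covariance: $\mathrm{cov}(a,b)=\rho(a\circ b)-\rho(a)\rho(b)$; variance: $\mathrm{var}(a)=\rho(a^2)-|\rho(a)|^2$. For $D_m\in A^+$ with $\sum_m\rho(D_m)<\infty$, the bundle is $\mathcal{P}_{(D_m)}=\{p\in A \text{ a projection}: p\neq 0,\ \sup_m\|p(\sum_{k=1}^m D_k)p\|<\infty,\ \|pD_mp\|\to0\}$. A sequence $x_n\in A$ is bundle convergent to $x\in A$ in $A$ if there is a bundle $\mathcal{P}_{(D_m)}$ (with $D_m\in A^+$, $\sum_m\rho(D_m)<\infty$) such that $\|p(x_n-x)^2p\|\to0$ for every $p\in\mathcal{P}_{(D_m)}$. The logarithm in (ii) is base $2$. *)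

theory Defs
  imports "HOL-Analysis.Analysis"
begin

class complex_hilbert = banach +
  fixes scaleC :: "complex \<Rightarrow> 'a \<Rightarrow> 'a"
    and cinner :: "'a \<Rightarrow> 'a \<Rightarrow> complex"
  assumes scaleC_add_right: "scaleC c (x + y) = scaleC c x + scaleC c y"
    and scaleC_add_left: "scaleC (c + d) x = scaleC c x + scaleC d x"
    and scaleC_scaleC: "scaleC c (scaleC d x) = scaleC (c * d) x"
    and scaleC_of_real: "scaleC (complex_of_real r) x = r *\<^sub>R x"
    and cinner_add_left: "cinner (x + y) z = cinner x z + cinner y z"
    and cinner_scaleC_left: "cinner (scaleC c x) y = cnj c * cinner x y"
    and cinner_commute: "cinner y x = cnj (cinner x y)"
    and cinner_self_nonneg: "Im (cinner x x) = 0 \<and> Re (cinner x x) \<ge> 0"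
    and cinner_self_eq_0: "cinner x x = 0 \<longleftrightarrow> x = 0"
    and norm_eq_sqrt_cinner: "norm x = sqrt (Re (cinner x x))"

definition bounded_op :: "('a::complex_hilbert \<Rightarrow> 'a) \<Rightarrow> bool" where
  "bounded_op T \<longleftrightarrow> (\<forall>x y. T (x + y) = T x + T y) \<and> (\<forall>c x. T (scaleC c x) = scaleC c (T x))
     \<and> (\<exists>K. \<forall>x. norm (T x) \<le> K * norm x)"

definition self_adjoint :: "('a::complex_hilbert \<Rightarrow> 'a) \<Rightarrow> bool" where
  "self_adjoint T \<longleftrightarrow> bounded_op T \<and> (\<forall>x y. cinner (T x) y = cinner x (T y))"

definition zero_op :: "'a::complex_hilbert \<Rightarrow> 'a" where "zero_op = (\<lambda>h. 0)"

definition op_add :: "('a::complex_hilbert \<Rightarrow> 'a) \<Rightarrow> ('a \<Rightarrow> 'a) \<Rightarrow> 'a \<Rightarrow> 'a" where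
  "op_add a b = (\<lambda>h. a h + b h)"

definition op_diff :: "('a::complex_hilbert \<Rightarrow> 'a) \<Rightarrow> ('a \<Rightarrow> 'a) \<Rightarrow> 'a \<Rightarrow> 'a" where
  "op_diff a b = (\<lambda>h. a h - b h)"

definition op_scaleR :: "real \<Rightarrow> ('a::complex_hilbert \<Rightarrow> 'a) \<Rightarrow> 'a \<Rightarrow> 'a" where
  "op_scaleR r a = (\<lambda>h. r *\<^sub>R a h)"

definition jordan :: "('a::complex_hilbert \<Rightarrow> 'a) \<Rightarrow> ('a \<Rightarrow> 'a) \<Rightarrow> 'a \<Rightarrow> 'a" where
  "jordan a b = (\<lambda>h. (1/2) *\<^sub>R (a (b h) + b (a h)))"

definition op_le :: "('a::complex_hilbert \<Rightarrow> 'a) \<Rightarrow> ('a \<Rightarrow> 'a) \<Rightarrow> bool" where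
  "op_le a b \<longleftrightarrow> (\<forall>x. Re (cinner (b x - a x) x) \<ge> 0)"

definition op_pos :: "('a::complex_hilbert \<Rightarrow> 'a) \<Rightarrow> bool" where
  "op_pos a \<longleftrightarrow> op_le zero_op a"

definition opnorm :: "('a::complex_hilbert \<Rightarrow> 'a) \<Rightarrow> real" where
  "opnorm T = onorm T"

(* Closedness in the weak operator topology: every bounded operator in the WOT-closure
  (i.e. approximable in finitely many matrix coefficients) belongs to A. *)
definition wot_closed :: "('a::complex_hilbert \<Rightarrow> 'a) set \<Rightarrow> bool" where
  "wot_closed A \<longleftrightarrow> (\<forall>T. bounded_op T \<and>
      (\<forall>F. finite F \<longrightarrow> (\<forall>\<epsilon>>0. \<exists>a\<in>A. \<forall>(x,y)\<in>F. cmod (cinner (T x - a x) y) < \<epsilon>))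
      \<longrightarrow> T \<in> A)"

definition JW_algebra :: "('a::complex_hilbert \<Rightarrow> 'a) set \<Rightarrow> bool" where
  "JW_algebra A \<longleftrightarrow> (\<forall>a\<in>A. self_adjoint a) \<and> id \<in> A
     \<and> (\<forall>a\<in>A. \<forall>b\<in>A. op_add a b \<in> A) \<and> (\<forall>r. \<forall>a\<in>A. op_scaleR r a \<in> A)
     \<and> (\<forall>a\<in>A. \<forall>b\<in>A. jordan a b \<in> A) \<and> wot_closed A"

definition reversible :: "('a::complex_hilbert \<Rightarrow> 'a) set \<Rightarrow> bool" where
  "reversible A \<longleftrightarrow> (\<forall>as. as \<noteq> [] \<and> set as \<subseteq> A \<longrightarrow>
       op_add (foldr (\<circ>) as id) (foldr (\<circ>) (rev as) id) \<in> A)"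

definition is_state :: "('a::complex_hilbert \<Rightarrow> 'a) set \<Rightarrow> (('a \<Rightarrow> 'a) \<Rightarrow> real) \<Rightarrow> bool" where
  "is_state A \<rho> \<longleftrightarrow> (\<forall>a\<in>A. \<forall>b\<in>A. \<rho> (op_add a b) = \<rho> a + \<rho> b)
     \<and> (\<forall>r. \<forall>a\<in>A. \<rho> (op_scaleR r a) = r * \<rho> a)
     \<and> (\<forall>a\<in>A. op_pos a \<longrightarrow> \<rho> a \<ge> 0) \<and> \<rho> id = 1"

definition faithful_state :: "('a::complex_hilbert \<Rightarrow> 'a) set \<Rightarrow> (('a \<Rightarrow> 'a) \<Rightarrow> real) \<Rightarrow> bool" where
  "faithful_state A \<rho> \<longleftrightarrow> (\<forall>a\<in>A. op_pos a \<and> \<rho> a = 0 \<longrightarrow> a = zero_op)"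

definition normal_state :: "('a::complex_hilbert \<Rightarrow> 'a) set \<Rightarrow> (('a \<Rightarrow> 'a) \<Rightarrow> real) \<Rightarrow> bool" where
  "normal_state A \<rho> \<longleftrightarrow> (\<forall>S s. S \<subseteq> A \<and> S \<noteq> {} \<and>
      (\<forall>a\<in>S. \<forall>b\<in>S. \<exists>c\<in>S. op_le a c \<and> op_le b c) \<and>
      s \<in> A \<and> (\<forall>a\<in>S. op_le a s) \<and> (\<forall>b\<in>A. (\<forall>a\<in>S. op_le a b) \<longrightarrow> op_le s b)
      \<longrightarrow> \<rho> s = (SUP a\<in>S. \<rho> a))"

definition cov :: "(('a::complex_hilbert \<Rightarrow> 'a) \<Rightarrow> real) \<Rightarrow> ('a \<Rightarrow> 'a) \<Rightarrow> ('a \<Rightarrow> 'a) \<Rightarrow> real" where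
  "cov \<rho> a b = \<rho> (jordan a b) - \<rho> a * \<rho> b"

definition var :: "(('a::complex_hilbert \<Rightarrow> 'a) \<Rightarrow> real) \<Rightarrow> ('a \<Rightarrow> 'a) \<Rightarrow> real" where
  "var \<rho> a = \<rho> (a \<circ> a) - \<bar>\<rho> a\<bar>\<^sup>2"

definition is_projection :: "('a::complex_hilbert \<Rightarrow> 'a) set \<Rightarrow> ('a \<Rightarrow> 'a) \<Rightarrow> bool" where
  "is_projection A p \<longleftrightarrow> p \<in> A \<and> p \<circ> p = p"

definition proj_bundle :: "('a::complex_hilbert \<Rightarrow> 'a) set \<Rightarrow> (nat \<Rightarrow> 'a \<Rightarrow> 'a) \<Rightarrow> ('a \<Rightarrow> 'a) set" where
  "proj_bundle A D = {p. is_projection A p \<and> p \<noteq> zero_op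
      \<and> bdd_above (range (\<lambda>m. opnorm (p \<circ> (\<lambda>h. \<Sum>k\<le>m. D k h) \<circ> p)))
      \<and> (\<lambda>m. opnorm (p \<circ> D m \<circ> p)) \<longlonglongrightarrow> 0}"

definition bundle_convergent ::
  "('a::complex_hilbert \<Rightarrow> 'a) set \<Rightarrow> (('a \<Rightarrow> 'a) \<Rightarrow> real) \<Rightarrow> (nat \<Rightarrow> 'a \<Rightarrow> 'a) \<Rightarrow> ('a \<Rightarrow> 'a) \<Rightarrow> bool" where
  "bundle_convergent A \<rho> x y \<longleftrightarrow> (\<exists>D. (\<forall>m. D m \<in> A \<and> op_pos (D m)) \<and> summable (\<lambda>m. \<rho> (D m))
      \<and> (\<forall>p\<in>proj_bundle A D. (\<lambda>n. opnorm (p \<circ> (op_diff (x n) y \<circ> op_diff (x n) y) \<circ> p)) \<longlonglongrightarrow> 0))"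

end

theory Submission
  imports Defs
begin

text \<open>Let \<open>y\<^sub>n = x\<^sub>n - \<rho>(x\<^sub>n)\<close> and let \<open>z\<^sub>k\<close> be the mean of the first \<open>k\<close> of the \<open>y\<^sub>n\<close>. As the \<open>y\<^sub>n\<close>
  are orthogonal for \<open>\<rho>(a \<circ> b)\<close>, Kronecker's lemma gives \<open>\<rho>(z\<^sub>k\<^sup>2) \<longlonglongrightarrow> 0\<close>; pass to a subsequence with
  summable \<open>\<rho>(z\<^sub>k\<^sup>2)\<close>. Let \<open>D\<^sub>k\<close> define the bundle along which \<open>x\<^sub>n\<close> converges to \<open>x\<close>, and let
  \<open>F\<^sub>k = w\<^sub>k (D\<^sub>k + z\<^sub>k\<^sup>2)\<close> with \<open>w\<^sub>k \<longlonglongrightarrow> \<infinity>\<close> and \<open>\<Sum> \<rho>(F\<^sub>k) < \<infinity>\<close>. A projection \<open>p\<close> compressing \<open>\<Sum> F\<^sub>k\<close> to a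
  bounded operator lies in the bundle of \<open>D\<close>, and \<open>z\<^sub>k p \<longlonglongrightarrow> 0\<close>; comparing with the Cesaro means of
  \<open>x\<^sub>n p \<longlonglongrightarrow> x p\<close> yields \<open>x p = \<gamma> p\<close> with \<open>\<gamma>\<close> independent of \<open>p\<close>. Such projections are abundant,
  being spectral projections of the infimum of \<open>(1 + t \<Sum>\<^sub>k\<^sub>\<le>\<^sub>m F\<^sub>k)\<^sup>-\<^sup>1\<close> over \<open>m\<close>, which tends to \<open>1\<close>
  in the state as \<open>t \<longlonglongrightarrow> 0\<close>. Faithfulness of \<open>\<rho>\<close> then forces \<open>x = \<gamma>\<close>.\<close>

section \<open>Positive operators\<close>

text \<open>The real part is a real inner product with the same norm. Order, adjoints and estimates
  are handled through it; the complex product returns only for weak operator closedness.\<close>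

definition rinner :: "'a::complex_hilbert \<Rightarrow> 'a \<Rightarrow> real" where
  "rinner x y = Re (cinner x y)"

lemma rinner_add_left: "rinner (x + y) z = rinner x z + rinner y z"
  by (simp add: rinner_def cinner_add_left)

lemma rinner_commute: "rinner x y = rinner y x"
  unfolding rinner_def by (subst cinner_commute) simp

lemma rinner_add_right: "rinner x (y + z) = rinner x y + rinner x z"
  by (metis rinner_add_left rinner_commute)

lemma rinner_scaleR_left: "rinner (r *\<^sub>R x) y = r * rinner x y"
  unfolding rinner_def scaleC_of_real[symmetric] cinner_scaleC_left by simp

lemma rinner_scaleR_right: "rinner x (r *\<^sub>R y) = r * rinner x y"
  by (metis rinner_scaleR_left rinner_commute)

lemma rinner_minus_left: "rinner (- x) y = - rinner x y"
  using rinner_scaleR_left[of "-1" x y] by simp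

lemma rinner_minus_right: "rinner x (- y) = - rinner x y"
  by (metis rinner_minus_left rinner_commute)

lemma rinner_diff_left: "rinner (x - y) z = rinner x z - rinner y z"
  using rinner_add_left[of x "- y" z] by (simp add: rinner_minus_left)

lemma rinner_diff_right: "rinner x (y - z) = rinner x y - rinner x z"
  by (metis rinner_diff_left rinner_commute)

lemmas rinner_simps = rinner_add_left rinner_add_right rinner_diff_left rinner_diff_right
  rinner_scaleR_left rinner_scaleR_right rinner_minus_left rinner_minus_right

lemma rinner_self: "rinner x x = (norm x)\<^sup>2"
  using cinner_self_nonneg[of x] by (simp add: rinner_def norm_eq_sqrt_cinner)

lemma rinner_zero [simp]: "rinner 0 x = 0" "rinner x 0 = 0"
  using rinner_scaleR_left[of 0 0 x] rinner_scaleR_right[of x 0 0] by simp_all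

lemma op_le_iff: "op_le a b \<longleftrightarrow> (\<forall>x. rinner (a x) x \<le> rinner (b x) x)"
  by (simp add: op_le_def flip: rinner_def) (simp add: rinner_simps)

lemma op_pos_iff: "op_pos a \<longleftrightarrow> (\<forall>x. 0 \<le> rinner (a x) x)"
  by (simp add: op_pos_def op_le_iff zero_op_def)

lemma op_posD: "op_pos a \<Longrightarrow> 0 \<le> rinner (a x) x"
  by (simp add: op_pos_iff)

lemma norm_scaleC: "norm (scaleC c x) = cmod c * norm x"
proof -
  have "cinner x (scaleC c x) = c * cinner x x"
    by (subst cinner_commute) (simp add: cinner_scaleC_left flip: cinner_commute)
  then have "cinner (scaleC c x) (scaleC c x) = c * cnj c * cinner x x"
    by (simp add: cinner_scaleC_left)
  also have "c * cnj c = complex_of_real ((cmod c)\<^sup>2)"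
    by (simp only: complex_norm_square)
  finally have "Re (cinner (scaleC c x) (scaleC c x)) = (cmod c)\<^sup>2 * Re (cinner x x)"
    by simp
  then show ?thesis
    by (simp add: norm_eq_sqrt_cinner real_sqrt_mult)
qed

lemma bounded_linear_scaleC: "bounded_linear (scaleC c :: 'a::complex_hilbert \<Rightarrow> 'a)"
proof (rule bounded_linear_intro[where K = "cmod c"])
  fix r :: real and x y :: 'a
  show "scaleC c (x + y) = scaleC c x + scaleC c y"
    by (rule scaleC_add_right)
  show "scaleC c (r *\<^sub>R x) = r *\<^sub>R scaleC c x"
    by (simp add: scaleC_scaleC mult.commute flip: scaleC_of_real)
qed (simp add: norm_scaleC mult.commute)

lemma bounded_op_bounded_linear:
  assumes "bounded_op T" shows "bounded_linear T"
proof -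
  obtain K where "\<forall>x. norm (T x) \<le> K * norm x"
    using assms by (auto simp: bounded_op_def)
  then show ?thesis
    using assms by (intro bounded_linear_intro[where K = K])
      (auto simp: bounded_op_def mult.commute simp flip: scaleC_of_real)
qed

lemma self_adjoint_bounded_linear: "self_adjoint a \<Longrightarrow> bounded_linear a"
  by (simp add: self_adjoint_def bounded_op_bounded_linear)

lemma self_adjoint_linear: "self_adjoint a \<Longrightarrow> linear a"
  by (simp add: bounded_linear.linear self_adjoint_bounded_linear)

lemma self_adjoint_rinner: "self_adjoint a \<Longrightarrow> rinner (a x) y = rinner x (a y)"
  by (simp add: self_adjoint_def rinner_def)

text \<open>Evaluate at the minimiser \<open>- \<beta> / \<gamma>\<close>. If
  \<open>\<gamma> = 0\<close> the expression is affine in \<open>t\<close>, and a nonzero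
  \<open>\<beta>\<close> would allow the value \<open>-1\<close>.\<close>

lemma nonneg_quadratic_discriminant:
  fixes \<alpha> \<beta> \<gamma> :: real
  assumes "\<And>t. 0 \<le> \<alpha> + 2 * t * \<beta> + t\<^sup>2 * \<gamma>" and "0 \<le> \<gamma>"
  shows "\<beta>\<^sup>2 \<le> \<alpha> * \<gamma>"
proof (cases "\<gamma> = 0")
  case True
  have "\<beta> = 0"
  proof (rule ccontr)
    assume "\<beta> \<noteq> 0"
    with assms(1)[of "- (\<alpha> + 1) / (2 * \<beta>)"] True show False
      by (simp add: field_simps)
  qed
  then show ?thesis using True by simp
next
  case False
  have "0 \<le> \<alpha> - \<beta>\<^sup>2 / \<gamma>"
    using assms(1)[of "- \<beta> / \<gamma>"] False by (simp add: power2_eq_square field_simps)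
  then show ?thesis
    using False assms(2) by (simp add: field_simps)
qed

text \<open>\<open>rinner (a x) y\<close> is a symmetric positive semidefinite form, so the
  discriminant argument along \<open>x + t y\<close> applies. The identity gives the usual
  inequality.\<close>

lemma positive_Cauchy_Schwarz:
  assumes a: "self_adjoint a" and pos: "op_pos a"
  shows "(rinner (a x) y)\<^sup>2 \<le> rinner (a x) x * rinner (a y) y"
proof (rule nonneg_quadratic_discriminant)
  fix t
  have "0 \<le> rinner (a (x + t *\<^sub>R y)) (x + t *\<^sub>R y)"
    using pos by (rule op_posD)
  also have "\<dots> = rinner (a x) x + t * rinner (a x) y + t * rinner (a y) x + t\<^sup>2 * rinner (a y) y"
    using self_adjoint_linear[OF a]
    by (simp add: linear_add linear_scale rinner_simps algebra_simps power2_eq_square)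
  also have "rinner (a y) x = rinner (a x) y"
    using self_adjoint_rinner[OF a] rinner_commute by metis
  finally show "0 \<le> rinner (a x) x + 2 * t * rinner (a x) y + t\<^sup>2 * rinner (a y) y"
    by simp
qed (rule op_posD[OF pos])

lemma self_adjoint_id: "self_adjoint id"
  by (auto simp: self_adjoint_def bounded_op_def intro: exI[of _ 1])

lemma abs_rinner_le: "\<bar>rinner x y\<bar> \<le> norm x * norm y"
proof -
  have "(rinner x y)\<^sup>2 \<le> (norm x * norm y)\<^sup>2"
    using positive_Cauchy_Schwarz[OF self_adjoint_id, of x y]
    by (simp add: op_pos_iff rinner_self power_mult_distrib)
  then have "\<bar>rinner x y\<bar> \<le> \<bar>norm x * norm y\<bar>"
    by (simp only: abs_le_square_iff)
  then show ?thesis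
    by simp
qed

text \<open>The imaginary part is a real part after rotating \<open>x\<close> by
  \<open>\<i>\<close>. The factor 2 comes from adding the two bounds and suffices for
  continuity.\<close>

lemma cmod_cinner_le: "cmod (cinner x y) \<le> 2 * (norm x * norm y)"
proof -
  have "Im (cinner x y) = rinner (scaleC \<i> x) y"
    by (simp add: rinner_def cinner_scaleC_left)
  then have "\<bar>Im (cinner x y)\<bar> \<le> norm x * norm y"
    using abs_rinner_le[of "scaleC \<i> x" y] by (simp add: norm_scaleC)
  moreover have "\<bar>Re (cinner x y)\<bar> \<le> norm x * norm y"
    using abs_rinner_le[of x y] by (simp add: rinner_def)
  ultimately show ?thesis
    using cmod_le[of "cinner x y"] by simp
qed

lemma bounded_linear_rinner_left: "bounded_linear (\<lambda>x. rinner x y)"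
  by (rule bounded_linear_intro[where K = "norm y"])
    (use abs_rinner_le in \<open>auto simp: rinner_simps\<close>)

lemma tendsto_cinner_left:
  assumes "f \<longlonglongrightarrow> l" shows "(\<lambda>n. cinner (f n) y) \<longlonglongrightarrow> cinner l y"
proof -
  have sum: "cinner u y - cinner v y = cinner (u - v) y" for u v
    using cinner_add_left[of "u - v" v y] by simp
  have "(\<lambda>n. 2 * (norm (f n - l) * norm y)) \<longlonglongrightarrow> 0"
    using assms by (intro tendsto_eq_intros | simp add: LIM_zero_iff tendsto_norm_zero)+
  then have "(\<lambda>n. cinner (f n) y - cinner l y) \<longlonglongrightarrow> 0"
    by (rule Lim_null_comparison[rotated]) (simp add: sum cmod_cinner_le)
  then show ?thesis by (simp add: LIM_zero_iff)
qed

text \<open>Cauchy-Schwarz for the form of \<open>a\<close> at \<open>x\<close> and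
  \<open>a x\<close>. The form bound is asked at the vector \<open>a x\<close> alone because in the
  spectral estimate it is known only on the kernel of a projection.\<close>

lemma norm_positive_le:
  assumes a: "self_adjoint a" "op_pos a" and le: "rinner (a (a x)) (a x) \<le> K * (norm (a x))\<^sup>2"
  shows "(norm (a x))\<^sup>2 \<le> K * rinner (a x) x"
proof (cases "a x = 0")
  case False
  have "((norm (a x))\<^sup>2)\<^sup>2 \<le> rinner (a x) x * rinner (a (a x)) (a x)"
    using positive_Cauchy_Schwarz[OF a, of x "a x"] by (simp add: rinner_self)
  also have "\<dots> \<le> rinner (a x) x * (K * (norm (a x))\<^sup>2)"
    using le op_posD[OF a(2)] by (rule mult_left_mono)
  finally show ?thesis
    using False by (simp add: power2_eq_square algebra_simps)
qed simp

lemma norm_positive_le_of_bound: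
  assumes a: "self_adjoint a" "op_pos a" and le: "\<And>x. rinner (a x) x \<le> K * (norm x)\<^sup>2" "0 \<le> K"
  shows "norm (a x) \<le> K * norm x"
proof -
  have "(norm (a x))\<^sup>2 \<le> K * rinner (a x) x"
    using norm_positive_le[OF a] le(1) by blast
  also have "\<dots> \<le> K * (K * (norm x)\<^sup>2)"
    using le by (intro mult_left_mono) auto
  finally have "(norm (a x))\<^sup>2 \<le> (K * norm x)\<^sup>2"
    by (simp add: power2_eq_square algebra_simps)
  then show ?thesis
    by (rule power2_le_imp_le) (simp add: le(2))
qed

lemma self_adjoint_boundE:
  assumes "self_adjoint a"
  obtains K where "0 < K" "\<And>x. norm (a x) \<le> K * norm x"
  using bounded_linear.pos_bounded[OF self_adjoint_bounded_linear[OF assms]]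
  by (metis mult.commute)

lemma rinner_le_of_norm_le: "norm (a x) \<le> K * norm x \<Longrightarrow> rinner (a x) x \<le> K * (norm x)\<^sup>2"
  using abs_rinner_le[of "a x" x] mult_right_mono[of "norm (a x)" "K * norm x" "norm x"]
  by (simp add: power2_eq_square)

section \<open>Strong limits in a JW-algebra\<close>

lemma bounded_op_strong_limit:
  assumes lin: "\<And>n. bounded_op (a n)"
    and lim: "\<And>h. (\<lambda>n. a n h) \<longlonglongrightarrow> T h"
    and bound: "\<And>n h. norm (a n h) \<le> K * norm h"
  shows "bounded_op T"
  unfolding bounded_op_def
proof (intro conjI allI exI)
  fix x y :: 'a and c
  have "(\<lambda>n. a n x + a n y) \<longlonglongrightarrow> T x + T y"
    by (intro tendsto_add lim)
  moreover have "(\<lambda>n. a n x + a n y) \<longlonglongrightarrow> T (x + y)"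
    using lim[of "x + y"] lin by (simp add: bounded_op_def)
  ultimately show "T (x + y) = T x + T y"
    by (rule LIMSEQ_unique[THEN sym])
  have "(\<lambda>n. scaleC c (a n x)) \<longlonglongrightarrow> scaleC c (T x)"
    by (intro bounded_linear.tendsto[OF bounded_linear_scaleC] lim)
  moreover have "(\<lambda>n. scaleC c (a n x)) \<longlonglongrightarrow> T (scaleC c x)"
    using lim[of "scaleC c x"] lin by (simp add: bounded_op_def)
  ultimately show "T (scaleC c x) = scaleC c (T x)"
    by (rule LIMSEQ_unique[THEN sym])
  show "norm (T x) \<le> K * norm x"
    by (rule LIMSEQ_le_const2[OF tendsto_norm[OF lim]]) (use bound in blast)
qed

locale jw_algebra =
  fixes A :: "('a::complex_hilbert \<Rightarrow> 'a) set"
  assumes jw: "JW_algebra A"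
begin

section \<open>Real-linear and Jordan operations inside \<open>A\<close>\<close>

lemma self_adjoint_mem: "a \<in> A \<Longrightarrow> self_adjoint a"
  using jw by (simp add: JW_algebra_def)

lemma bounded_linear_mem: "a \<in> A \<Longrightarrow> bounded_linear a"
  by (simp add: self_adjoint_mem self_adjoint_bounded_linear)

lemma
  assumes "a \<in> A"
  shows apply_add: "a (x + y) = a x + a y"
    and apply_diff: "a (x - y) = a x - a y"
    and apply_scaleR: "a (r *\<^sub>R x) = r *\<^sub>R a x"
    and apply_zero: "a 0 = 0"
    and apply_sum: "a (\<Sum>i\<in>I. f i) = (\<Sum>i\<in>I. a (f i))"
  using self_adjoint_linear[OF self_adjoint_mem[OF assms]]
  by (simp_all add: linear_add linear_diff linear_scale linear_0 linear_sum)

lemmas apply_simps = apply_add apply_diff apply_scaleR apply_zero apply_sum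

lemma apply_rinner: "a \<in> A \<Longrightarrow> rinner (a x) y = rinner x (a y)"
  by (simp add: self_adjoint_mem self_adjoint_rinner)

lemma id_mem: "(\<lambda>h. h) \<in> A"
  using jw by (simp add: JW_algebra_def id_def)

lemma add_mem: "a \<in> A \<Longrightarrow> b \<in> A \<Longrightarrow> (\<lambda>h. a h + b h) \<in> A"
  using jw by (simp add: JW_algebra_def op_add_def)

lemma scaleR_mem: "a \<in> A \<Longrightarrow> (\<lambda>h. r *\<^sub>R a h) \<in> A"
  using jw by (simp add: JW_algebra_def op_scaleR_def)

lemma diff_mem: "a \<in> A \<Longrightarrow> b \<in> A \<Longrightarrow> (\<lambda>h. a h - b h) \<in> A"
  using add_mem[of a "\<lambda>h. (-1) *\<^sub>R b h"] scaleR_mem[of b "-1"] by simp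

lemma zero_mem: "(\<lambda>h. 0) \<in> A"
  using scaleR_mem[OF id_mem, of 0] by simp

lemma sum_mem:
  assumes "\<And>i. i \<in> I \<Longrightarrow> f i \<in> A"
  shows "(\<lambda>h. \<Sum>i\<in>I. f i h) \<in> A"
  using assms by (induction I rule: infinite_finite_induct) (auto simp: zero_mem intro: add_mem)

lemma jordan_mem: "a \<in> A \<Longrightarrow> b \<in> A \<Longrightarrow> jordan a b \<in> A"
  using jw by (simp add: JW_algebra_def)

text \<open>Commuting operators have their composition as Jordan product. This is how squares and
  powers stay in \<open>A\<close>.\<close>

lemma comp_mem:
  assumes "a \<in> A" "b \<in> A" "\<And>h. a (b h) = b (a h)"
  shows "(\<lambda>h. a (b h)) \<in> A"
  using jordan_mem[OF assms(1,2)] by (simp add: jordan_def flip: assms(3))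

lemma square_mem: "a \<in> A \<Longrightarrow> (\<lambda>h. a (a h)) \<in> A"
  by (rule comp_mem) auto

lemma funpow_mem: "a \<in> A \<Longrightarrow> a ^^ n \<in> A"
proof (induction n)
  case (Suc n)
  then show ?case
    using comp_mem[of a "a ^^ n"] by (simp add: funpow_swap1 comp_def)
qed (simp add: id_mem id_def)

lemma bound_mem:
  assumes "a \<in> A"
  obtains K where "0 < K" "\<And>x. norm (a x) \<le> K * norm x"
  using self_adjoint_boundE[OF self_adjoint_mem[OF assms]] by blast

text \<open>Strong convergence gives convergence of every matrix coefficient, so one index serves
  the finitely many coefficients in \<open>wot_closed\<close>. The uniform bound \<open>K\<close>
  makes the limit a bounded operator.\<close>

lemma strong_limit_mem:
  assumes mem: "\<And>n. a n \<in> A"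
    and lim: "\<And>h. (\<lambda>n. a n h) \<longlonglongrightarrow> T h"
    and bound: "\<And>n h. norm (a n h) \<le> K * norm h"
  shows "T \<in> A"
proof -
  have "bounded_op (a n)" for n
    using self_adjoint_mem[OF mem] by (simp add: self_adjoint_def)
  then have T: "bounded_op T"
    by (rule bounded_op_strong_limit) (fact lim bound)+
  have "\<exists>b\<in>A. \<forall>(x, y)\<in>F. cmod (cinner (T x - b x) y) < \<epsilon>"
    if "finite F" "0 < \<epsilon>" for F and \<epsilon> :: real
  proof -
    have "eventually (\<lambda>n. case p of (x, y) \<Rightarrow> cmod (cinner (T x - a n x) y) < \<epsilon>) sequentially" for p
    proof -
      obtain x y where p: "p = (x, y)" by (cases p)
      have "(\<lambda>n. T x - a n x) \<longlonglongrightarrow> T x - T x"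
        by (intro tendsto_intros lim)
      then have "(\<lambda>n. cinner (T x - a n x) y) \<longlonglongrightarrow> cinner (T x - T x) y"
        by (rule tendsto_cinner_left)
      moreover have "cinner (T x - T x) y = 0"
        using cinner_add_left[of 0 0 y] by simp
      ultimately have "eventually (\<lambda>n. dist (cinner (T x - a n x) y) 0 < \<epsilon>) sequentially"
        using \<open>0 < \<epsilon>\<close> by (metis tendstoD)
      then show ?thesis
        by (simp add: p)
    qed
    then have "eventually (\<lambda>n. \<forall>p\<in>F. case p of (x, y) \<Rightarrow> cmod (cinner (T x - a n x) y) < \<epsilon>) sequentially"
      using \<open>finite F\<close> by (simp add: eventually_ball_finite)
    then obtain n where "\<forall>p\<in>F. case p of (x, y) \<Rightarrow> cmod (cinner (T x - a n x) y) < \<epsilon>"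
      using eventually_happens by fastforce
    then show ?thesis
      using mem by blast
  qed
  moreover have "wot_closed A"
    using jw by (simp add: JW_algebra_def)
  ultimately show ?thesis
    using T by (auto simp: wot_closed_def)
qed

text \<open>For \<open>m \<le> n\<close> the difference \<open>d = a n - a m\<close> is positive
  with form at most \<open>K\<close>, so the squared norm of \<open>d h\<close> is at most
  \<open>K * rinner (d h) h\<close>. The numerical sequence is increasing and bounded, hence Cauchy,
  and this transfers to the vectors.\<close>

lemma monotone_limit:
  assumes mem: "\<And>n. a n \<in> A"
    and mono: "\<And>n h. rinner (a n h) h \<le> rinner (a (Suc n) h) h"
    and pos: "\<And>h. 0 \<le> rinner (a 0 h) h"
    and bound: "\<And>n h. rinner (a n h) h \<le> K * (norm h)\<^sup>2" "0 \<le> K"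
  obtains T where "T \<in> A" "\<And>h. (\<lambda>n. a n h) \<longlonglongrightarrow> T h"
proof -
  have inc: "incseq (\<lambda>n. rinner (a n h) h)" for h
    by (rule incseq_SucI) (rule mono)
  have nonneg: "0 \<le> rinner (a n h) h" for n h
    using incseqD[OF inc, of 0 n h] pos[of h] by simp
  have diff_le: "(norm (a n h - a m h))\<^sup>2 \<le> K * (rinner (a n h) h - rinner (a m h) h)"
    if "m \<le> n" for m n h
  proof -
    define d where "d = (\<lambda>h. a n h - a m h)"
    have d: "d \<in> A"
      unfolding d_def by (intro diff_mem mem)
    have "op_pos d"
      using incseqD[OF inc that] by (simp add: op_pos_iff d_def rinner_simps)
    moreover have "rinner (d h) h \<le> K * (norm h)\<^sup>2" for h
      using bound(1)[of n h] nonneg[of m h] by (simp add: d_def rinner_simps)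
    ultimately have "(norm (d h))\<^sup>2 \<le> K * rinner (d h) h"
      using norm_positive_le[OF self_adjoint_mem[OF d]] by blast
    then show ?thesis
      by (simp add: d_def rinner_simps)
  qed
  have "convergent (\<lambda>n. a n h)" for h
  proof -
    have "convergent (\<lambda>n. rinner (a n h) h)"
      by (rule incseq_convergent[OF inc, of h "K * (norm h)\<^sup>2"]) (auto simp: bound convergent_def)
    then have C: "Cauchy (\<lambda>n. rinner (a n h) h)"
      by (rule convergent_Cauchy)
    have "Cauchy (\<lambda>n. a n h)"
    proof (rule CauchyI')
      fix e :: real assume "0 < e"
      \<comment> \<open>Dividing by \<open>K + 1\<close> covers \<open>K = 0\<close> and leaves the
        final inequality strict.\<close>
      then have "0 < e\<^sup>2 / (K + 1)"
        using bound(2) by simp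
      then obtain M where M: "\<And>m n. m \<ge> M \<Longrightarrow> n \<ge> M \<Longrightarrow> norm (rinner (a m h) h - rinner (a n h) h) < e\<^sup>2 / (K + 1)"
        using CauchyD[OF C] by blast
      show "\<exists>M. \<forall>m\<ge>M. \<forall>n>m. dist (a m h) (a n h) < e"
      proof (intro exI allI impI)
        fix m n assume mn: "M \<le> m" "m < n"
        have "(norm (a n h - a m h))\<^sup>2 \<le> K * (rinner (a n h) h - rinner (a m h) h)"
          using mn by (intro diff_le) simp
        also have "\<dots> \<le> K * (e\<^sup>2 / (K + 1))"
          using M[of n m] mn bound(2) by (intro mult_left_mono) auto
        also have "\<dots> < e\<^sup>2"
          using bound(2) \<open>0 < e\<close> by (simp add: field_simps)
        finally show "dist (a m h) (a n h) < e"
          using \<open>0 < e\<close> by (simp add: dist_norm norm_minus_commute power_less_imp_less_base)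
      qed
    qed
    then show ?thesis by (rule Cauchy_convergent)
  qed
  then obtain T where T: "\<And>h. (\<lambda>n. a n h) \<longlonglongrightarrow> T h"
    unfolding convergent_def by metis
  have "norm (a n h) \<le> K * norm h" for n h
    using norm_positive_le_of_bound[OF self_adjoint_mem[OF mem]] bound nonneg by (auto simp: op_pos_iff)
  then have "T \<in> A"
    using strong_limit_mem[of a T K] mem T by blast
  then show thesis using T by (rule that)
qed

end

section \<open>Square roots, spectral projections and resolvents\<close>

text \<open>Split \<open>a n (x n)\<close> into \<open>a n (x n - x0) + a n x0\<close>; the uniform
  bound sends the first term to zero.\<close>

lemma strong_limit_comp:
  fixes a :: "nat \<Rightarrow> 'a::complex_hilbert \<Rightarrow> 'a"
  assumes lin: "\<And>n. linear (a n)"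
    and lim: "\<And>h. (\<lambda>n. a n h) \<longlonglongrightarrow> T h" and bound: "\<And>n h. norm (a n h) \<le> K * norm h"
    and x: "x \<longlonglongrightarrow> x0"
  shows "(\<lambda>n. a n (x n)) \<longlonglongrightarrow> T x0"
proof -
  have "(\<lambda>n. K * norm (x n - x0)) \<longlonglongrightarrow> 0"
    using x by (intro tendsto_mult_right_zero) (simp add: LIM_zero_iff tendsto_norm_zero)
  then have "(\<lambda>n. a n (x n - x0)) \<longlonglongrightarrow> 0"
    by (rule Lim_null_comparison[rotated]) (simp add: bound)
  then have "(\<lambda>n. a n (x n - x0) + a n x0) \<longlonglongrightarrow> 0 + T x0"
    by (intro tendsto_add lim)
  then show ?thesis
    using lin by (simp add: linear_diff)
qed

text \<open>Polynomials in \<open>u\<close> with nonnegative coefficients, kept as operators instead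
  of coefficient lists, so that membership in \<open>A\<close>, positivity and closure under
  composition follow by rule induction.\<close>

inductive_set nonneg_polys :: "('a::complex_hilbert \<Rightarrow> 'a) \<Rightarrow> ('a \<Rightarrow> 'a) set"
  for u :: "'a \<Rightarrow> 'a"
where
  power: "u ^^ n \<in> nonneg_polys u"
| add: "p \<in> nonneg_polys u \<Longrightarrow> q \<in> nonneg_polys u \<Longrightarrow> (\<lambda>h. p h + q h) \<in> nonneg_polys u"
| scaleR: "p \<in> nonneg_polys u \<Longrightarrow> 0 \<le> r \<Longrightarrow> (\<lambda>h. r *\<^sub>R p h) \<in> nonneg_polys u"

primrec sqrt_iter :: "('a::complex_hilbert \<Rightarrow> 'a) \<Rightarrow> nat \<Rightarrow> 'a \<Rightarrow> 'a" where
  "sqrt_iter u 0 = (\<lambda>h. 0)"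
| "sqrt_iter u (Suc n) = (\<lambda>h. (1/2) *\<^sub>R (u h + sqrt_iter u n (sqrt_iter u n h)))"

context jw_algebra
begin

lemma linear_mem: "a \<in> A \<Longrightarrow> linear a"
  by (simp add: self_adjoint_linear self_adjoint_mem)

lemma tendsto_apply: "a \<in> A \<Longrightarrow> (f \<longlongrightarrow> l) F \<Longrightarrow> ((\<lambda>n. a (f n)) \<longlongrightarrow> a l) F"
  by (rule bounded_linear.tendsto[OF bounded_linear_mem])

lemma nonneg_polys_mem: "p \<in> nonneg_polys u \<Longrightarrow> u \<in> A \<Longrightarrow> p \<in> A"
  by (induction rule: nonneg_polys.induct) (auto intro: add_mem scaleR_mem funpow_mem)

lemma nonneg_polys_comp:
  assumes u: "u \<in> A" and "p \<in> nonneg_polys u" and q: "q \<in> nonneg_polys u"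
  shows "(\<lambda>h. p (q h)) \<in> nonneg_polys u"
  using assms(2)
proof (induction rule: nonneg_polys.induct)
  case (power n)
  note lin = apply_simps[OF funpow_mem[OF u]]
  from q show ?case
  proof (induction rule: nonneg_polys.induct)
    case (power m)
    show ?case
      using nonneg_polys.power[where n = "n + m"] by (simp add: funpow_add comp_def)
  qed (auto simp: lin intro: nonneg_polys.intros)
qed (auto intro: nonneg_polys.intros)

lemma funpow_rinner: "u \<in> A \<Longrightarrow> rinner ((u ^^ (n + m)) x) y = rinner ((u ^^ m) x) ((u ^^ n) y)"
  by (simp add: funpow_add apply_rinner funpow_mem)

text \<open>Powers decide: an even power is the square of a self-adjoint operator, an odd one is
  \<open>u\<close> between two equal powers.\<close>

lemma nonneg_polys_pos:
  assumes u: "u \<in> A" "op_pos u" and "p \<in> nonneg_polys u"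
  shows "op_pos p"
  using assms(3)
proof (induction rule: nonneg_polys.induct)
  case (power n)
  have "0 \<le> rinner ((u ^^ n) h) h" for h
  proof (cases "even n")
    case True
    then obtain k where "n = k + k" by (metis evenE mult_2)
    then show ?thesis
      using u(1) by (simp add: funpow_rinner rinner_self)
  next
    case False
    then obtain k where "n = k + Suc k" by (metis oddE mult_2 add_Suc_right Suc_eq_plus1)
    then have "rinner ((u ^^ n) h) h = rinner (u ((u ^^ k) h)) ((u ^^ k) h)"
      using u(1) by (simp only: funpow_rinner) simp
    then show ?thesis
      using op_posD[OF u(2)] by simp
  qed
  then show ?case by (simp add: op_pos_iff)
qed (auto simp: op_pos_iff rinner_simps)

text \<open>With \<open>w\<close> an iterate and \<open>d\<close> the next difference,
  \<open>(w + d)\<^sup>2 - w\<^sup>2 = d (w + d) + w d\<close> contains no subtraction, so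
  nonnegative coefficients pass to the following difference.\<close>

lemma sqrt_iter_diff:
  assumes u: "u \<in> A"
  shows "sqrt_iter u n \<in> nonneg_polys u \<and>
    (\<lambda>h. sqrt_iter u (Suc n) h - sqrt_iter u n h) \<in> nonneg_polys u"
proof (induction n)
  case 0
  have "(\<lambda>h. 0 *\<^sub>R (u ^^ 0) h) \<in> nonneg_polys u" "(\<lambda>h. (1/2) *\<^sub>R (u ^^ 1) h) \<in> nonneg_polys u"
    by (intro nonneg_polys.intros; simp)+
  then show ?case by simp
next
  case (Suc n)
  define w where "w = sqrt_iter u n"
  define d where "d = (\<lambda>h. sqrt_iter u (Suc n) h - sqrt_iter u n h)"
  have w: "w \<in> nonneg_polys u" and d: "d \<in> nonneg_polys u"
    using Suc by (simp_all add: w_def d_def)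
  have wd: "sqrt_iter u (Suc n) = (\<lambda>h. w h + d h)"
    by (simp add: w_def d_def)
  have "(\<lambda>h. (1/2) *\<^sub>R (d (w h + d h) + w (d h))) \<in> nonneg_polys u"
    by (intro nonneg_polys.scaleR nonneg_polys.add nonneg_polys_comp[OF u d nonneg_polys.add[OF w d]]
        nonneg_polys_comp[OF u w d]) simp
  moreover have "sqrt_iter u (Suc (Suc n)) h - sqrt_iter u (Suc n) h
      = (1/2) *\<^sub>R (d (w h + d h) + w (d h))" for h
  proof -
    have "sqrt_iter u (Suc (Suc n)) h = (1/2) *\<^sub>R (u h + (w (w h + d h) + d (w h + d h)))"
      by (subst sqrt_iter.simps(2)) (simp only: wd)
    moreover have "sqrt_iter u (Suc n) h = (1/2) *\<^sub>R (u h + w (w h))"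
      by (simp add: w_def)
    ultimately show ?thesis
      using apply_add[OF nonneg_polys_mem[OF w u]] by (simp add: algebra_simps)
  qed
  ultimately have "(\<lambda>h. sqrt_iter u (Suc (Suc n)) h - sqrt_iter u (Suc n) h) \<in> nonneg_polys u"
    by presburger
  moreover have "sqrt_iter u (Suc n) \<in> nonneg_polys u"
    unfolding wd by (rule nonneg_polys.add[OF w d])
  ultimately show ?case
    by blast
qed

lemma norm_sqrt_iter_le:
  assumes "\<And>h. norm (u h) \<le> norm h" shows "norm (sqrt_iter u n h) \<le> norm h"
proof (induction n arbitrary: h)
  case (Suc n)
  have "norm (u h + sqrt_iter u n (sqrt_iter u n h)) \<le> norm h + norm h"
    by (rule norm_triangle_le) (intro add_mono assms order.trans[OF Suc Suc])
  then show ?case by simp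
qed simp

text \<open>With \<open>u = 1 - c\<close>, the square root \<open>1 - w\<close> of \<open>c\<close> corresponds to a fixed point
  of \<open>w \<mapsto> (u + w\<^sup>2) / 2\<close>. The iterates from \<open>0\<close> and their successive differences are
  polynomials in \<open>u\<close> with nonnegative coefficients, so the iteration is increasing.\<close>
lemma sqrt_exists:
  assumes c: "c \<in> A" "op_pos c" and le: "\<And>h. rinner (c h) h \<le> (norm h)\<^sup>2"
  obtains R where "R \<in> A" "op_pos R" "\<And>h. R (R h) = c h"
    "\<And>d h. d \<in> A \<Longrightarrow> (\<And>h. d (c h) = c (d h)) \<Longrightarrow> d (R h) = R (d h)"
proof -
  define u where "u = (\<lambda>h. h - c h)"
  have u: "u \<in> A" unfolding u_def by (intro diff_mem id_mem c)
  have u_pos: "op_pos u"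
    using le by (simp add: op_pos_iff u_def rinner_simps rinner_self)
  have u_norm: "norm (u h) \<le> norm h" for h
    using norm_positive_le_of_bound[OF self_adjoint_mem[OF u] u_pos, of 1 h] op_posD[OF c(2)]
    by (simp add: u_def rinner_simps rinner_self)
  define w where "w = sqrt_iter u"
  have w_norm: "norm (w n h) \<le> norm h" for n h
    unfolding w_def using u_norm by (rule norm_sqrt_iter_le)
  have w_mem: "w n \<in> A" for n
    unfolding w_def using sqrt_iter_diff[OF u] nonneg_polys_mem u by blast
  have w_mono: "rinner (w n h) h \<le> rinner (w (Suc n) h) h" for n h
    using op_posD[OF nonneg_polys_pos[OF u u_pos conjunct2[OF sqrt_iter_diff[OF u]]], of n h]
    unfolding w_def by (simp only: rinner_simps)
  have w_zero: "0 \<le> rinner (w 0 h) h" for h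
    by (simp add: w_def)
  have w_le: "rinner (w n h) h \<le> 1 * (norm h)\<^sup>2" for n h
    by (rule rinner_le_of_norm_le) (simp add: w_norm)
  obtain W where W: "W \<in> A" "\<And>h. (\<lambda>n. w n h) \<longlonglongrightarrow> W h"
    using monotone_limit[of w 1, OF w_mem w_mono w_zero w_le zero_le_one] by blast
  have W_norm: "norm (W h) \<le> norm h" for h
    by (rule LIMSEQ_le_const2[OF tendsto_norm[OF W(2)]]) (use w_norm in blast)
  have W_eq: "W h = (1/2) *\<^sub>R (u h + W (W h))" for h
  proof -
    have "(\<lambda>n. w n (w n h)) \<longlonglongrightarrow> W (W h)"
      by (rule strong_limit_comp[where K = 1]) (use linear_mem[OF w_mem] W w_norm in auto)
    then have "(\<lambda>n. (1/2) *\<^sub>R (u h + w n (w n h))) \<longlonglongrightarrow> (1/2) *\<^sub>R (u h + W (W h))"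
      by (intro tendsto_intros)
    moreover have "(\<lambda>n. (1/2) *\<^sub>R (u h + w n (w n h))) \<longlonglongrightarrow> W h"
      using LIMSEQ_Suc[OF W(2)[of h]] by (simp add: w_def)
    ultimately show ?thesis by (metis LIMSEQ_unique)
  qed
  define R where "R = (\<lambda>h. h - W h)"
  have "R \<in> A" unfolding R_def by (intro diff_mem id_mem W)
  moreover have "op_pos R"
    using rinner_le_of_norm_le[where a = W and K = 1] W_norm by (simp add: op_pos_iff R_def rinner_simps rinner_self)
  moreover have "R (R h) = c h" for h
  proof -
    have "2 *\<^sub>R W h = u h + W (W h)" using W_eq[of h] by (metis scaleR_half_double scaleR_right.add scaleR_2 scaleR_half_double)
    then show ?thesis
      by (simp add: R_def apply_diff[OF W(1)] u_def scaleR_2 algebra_simps)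
  qed
  \<comment> \<open>An operator commuting with \<open>c\<close> commutes with every polynomial
    iterate and, by continuity, with the strong limit.\<close>
  moreover have "d (R h) = R (d h)" if d: "d \<in> A" and comm: "\<And>h. d (c h) = c (d h)" for d h
  proof -
    have du: "d (u h) = u (d h)" for h
      by (simp add: u_def apply_diff[OF d] comm)
    have "d (w n h) = w n (d h)" for n h
      by (induction n arbitrary: h) (simp_all add: w_def apply_simps[OF d] du)
    then have "(\<lambda>n. w n (d h)) \<longlonglongrightarrow> d (W h)"
      using tendsto_apply[OF d W(2)[of h]] by simp
    then have "d (W h) = W (d h)"
      using W(2)[of "d h"] by (rule LIMSEQ_unique)
    then show ?thesis by (simp add: R_def apply_diff[OF d])
  qed
  ultimately show thesis by (rule that)
qed

text \<open>\<open>R\<close> is the absolute value of \<open>T\<close>. Scaling the square of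
  \<open>T\<close> by \<open>1 / K\<^sup>2\<close> brings it below the identity, where a square root
  \<open>Q\<close> exists, and \<open>R\<close> is \<open>K\<close> times \<open>Q\<close>.\<close>

lemma abs_exists:
  assumes T: "T \<in> A"
  obtains R where "R \<in> A" "op_pos R" "\<And>h. R (R h) = T (T h)" "\<And>h. T (R h) = R (T h)"
proof -
  obtain K where K: "0 < K" "\<And>x. norm (T x) \<le> K * norm x"
    using bound_mem[OF T] by blast
  define c where "c = (\<lambda>h. (1 / K\<^sup>2) *\<^sub>R T (T h))"
  have c: "c \<in> A" unfolding c_def by (intro scaleR_mem square_mem T)
  have c_rinner: "rinner (c h) h = (norm (T h))\<^sup>2 / K\<^sup>2" for h
    by (simp add: c_def rinner_simps apply_rinner[OF T] rinner_self)
  have "op_pos c" by (simp add: op_pos_iff c_rinner)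
  moreover have "rinner (c h) h \<le> (norm h)\<^sup>2" for h
    using K(1) power_mono[OF K(2)[of h], of 2]
    by (simp add: c_rinner field_simps power_mult_distrib)
  ultimately obtain Q where Q: "Q \<in> A" "op_pos Q" "\<And>h. Q (Q h) = c h"
    "\<And>d h. d \<in> A \<Longrightarrow> (\<And>h. d (c h) = c (d h)) \<Longrightarrow> d (Q h) = Q (d h)"
    using sqrt_exists[OF c] by blast
  have "T (Q h) = Q (T h)" for h
    by (rule Q(4)[OF T]) (simp add: c_def apply_simps[OF T])
  moreover have "Q (K *\<^sub>R Q h) = (1 / K) *\<^sub>R T (T h)" for h
    using K(1) by (simp add: apply_scaleR[OF Q(1)] Q(3) c_def power2_eq_square)
  ultimately show thesis
    using that[of "\<lambda>h. K *\<^sub>R Q h"] Q(1,2) K(1)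
    by (auto simp: scaleR_mem op_pos_iff rinner_simps apply_simps[OF T])
qed

text \<open>The contraction \<open>u = 1 - N\<^sup>2 / K\<^sup>2\<close> fixes exactly the kernel of
  \<open>N\<close>, and \<open>p\<close> is the strong limit of its even powers. Commutation passes
  to the limit.\<close>

lemma kernel_projection_exists:
  assumes N: "N \<in> A"
  obtains p where "p \<in> A" "\<And>h. p (p h) = p h" "\<And>h. N (p h) = 0" "\<And>h. N h = 0 \<Longrightarrow> p h = h"
    "\<And>d h. d \<in> A \<Longrightarrow> (\<And>h. d (N h) = N (d h)) \<Longrightarrow> d (p h) = p (d h)"
proof -
  obtain K where K: "0 < K" "\<And>x. norm (N x) \<le> K * norm x"
    using bound_mem[OF N] by blast
  define c where "c = (\<lambda>h. (1 / K\<^sup>2) *\<^sub>R N (N h))"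
  have c: "c \<in> A" unfolding c_def by (intro scaleR_mem square_mem N)
  have c_rinner: "rinner (c h) h = (norm (N h))\<^sup>2 / K\<^sup>2" for h
    by (simp add: c_def rinner_simps apply_rinner[OF N] rinner_self)
  have c_pos: "op_pos c" by (simp add: op_pos_iff c_rinner)
  have "rinner (c h) h \<le> 1 * (norm h)\<^sup>2" for h
    using K(1) power_mono[OF K(2)[of h], of 2]
    by (simp add: c_rinner field_simps power_mult_distrib)
  then have c_le: "(norm (c h))\<^sup>2 \<le> rinner (c h) h" for h
    using norm_positive_le[OF self_adjoint_mem[OF c] c_pos, of h 1] by simp
  define u where "u = (\<lambda>h. h - c h)"
  have u: "u \<in> A" unfolding u_def by (intro diff_mem id_mem c)
  have u_norm2: "(norm (u h))\<^sup>2 \<le> (norm h)\<^sup>2 - rinner (c h) h" for h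
    using c_le[of h] rinner_commute[of h "c h"]
    by (simp add: u_def rinner_simps flip: rinner_self)
  have u_norm: "norm (u h) \<le> norm h" for h
    by (rule power2_le_imp_le[OF order.trans[OF u_norm2]]) (simp_all add: op_posD[OF c_pos])
  have pow_norm: "norm ((u ^^ n) h) \<le> norm h" for n h
    by (induction n) (auto intro: order.trans[OF u_norm])
  have pow_rinner: "rinner ((u ^^ (n + n)) h) h = (norm ((u ^^ n) h))\<^sup>2" for n h
    using funpow_rinner[OF u, of n n h h] by (simp add: rinner_self)
  \<comment> \<open>Even powers have the form of a squared norm, which decreases along a
    contraction; subtracting from the identity gives an increasing sequence.\<close>
  define a where "a n = (\<lambda>h. h - (u ^^ (n + n)) h)" for n
  have a_mem: "a n \<in> A" for n
    unfolding a_def by (intro diff_mem id_mem funpow_mem u)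
  have a_rinner: "rinner (a n h) h = (norm h)\<^sup>2 - (norm ((u ^^ n) h))\<^sup>2" for n h
    unfolding a_def rinner_simps pow_rinner rinner_self ..
  have a_mono: "rinner (a n h) h \<le> rinner (a (Suc n) h) h" for n h
    by (simp add: a_rinner power_mono u_norm)
  have a_bounds: "0 \<le> rinner (a 0 h) h" "rinner (a n h) h \<le> 1 * (norm h)\<^sup>2" for n h
    by (simp_all add: a_rinner)
  obtain T where T: "T \<in> A" "\<And>h. (\<lambda>n. a n h) \<longlonglongrightarrow> T h"
    using monotone_limit[of a 1, OF a_mem a_mono a_bounds zero_le_one] by blast
  define p where "p = (\<lambda>h. h - T h)"
  have p: "p \<in> A" unfolding p_def by (intro diff_mem id_mem T)
  have lim: "(\<lambda>n. (u ^^ (n + n)) h) \<longlonglongrightarrow> p h" for h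
    using tendsto_diff[OF tendsto_const T(2)[of h], of h] by (simp add: a_def p_def)
  have uup: "u (u (p h)) = p h" for h
  proof -
    have "(\<lambda>n. (u ^^ (Suc n + Suc n)) h) \<longlonglongrightarrow> u (u (p h))"
      using tendsto_apply[OF u tendsto_apply[OF u lim[of h]]] by simp
    then show ?thesis
      using LIMSEQ_Suc[OF lim[of h]] LIMSEQ_unique by blast
  qed
  \<comment> \<open>On the range of \<open>p\<close> two applications of \<open>u\<close> change
    nothing, so \<open>u\<close> loses no norm there; the loss is at least the form of
    \<open>c\<close>, which must vanish.\<close>
  have Np: "N (p h) = 0" for h
  proof -
    have "norm (p h) \<le> norm (u (p h))" using u_norm[of "u (p h)"] uup by simp
    then have "(norm (p h))\<^sup>2 \<le> (norm (u (p h)))\<^sup>2" by (simp add: power_mono)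
    then have "rinner (c (p h)) (p h) \<le> 0" using u_norm2[of "p h"] by linarith
    then have "(norm (N (p h)))\<^sup>2 \<le> 0" using K(1) by (simp add: c_rinner divide_le_0_iff)
    then show ?thesis by simp
  qed
  have fixed: "p h = h" if "N h = 0" for h
  proof -
    have "u h = h" by (simp add: u_def c_def that apply_zero[OF N])
    then have "(u ^^ n) h = h" for n by (induction n) simp_all
    then show ?thesis using lim[of h] by (simp add: LIMSEQ_const_iff)
  qed
  have "d (p h) = p (d h)" if d: "d \<in> A" and comm: "\<And>h. d (N h) = N (d h)" for d h
  proof -
    have "d (u h) = u (d h)" for h
      by (simp add: u_def c_def apply_simps[OF d] comm)
    then have "d ((u ^^ n) h) = (u ^^ n) (d h)" for n h
      by (induction n) simp_all
    then have "(\<lambda>n. (u ^^ (n + n)) (d h)) \<longlonglongrightarrow> d (p h)"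
      using tendsto_apply[OF d lim[of h]] by simp
    then show ?thesis
      using lim[of "d h"] by (rule LIMSEQ_unique)
  qed
  then show thesis
    using that[of p] p fixed Np by blast
qed

text \<open>With \<open>T = b - \<delta>\<close>, the operator \<open>N\<close> is twice the
  negative part of \<open>T\<close>. Its kernel projection is the spectral projection of
  \<open>b\<close> for the half-line from \<open>\<delta>\<close> upwards, where \<open>T\<close>
  equals its absolute value \<open>R\<close>.\<close>

lemma spectral_projection_exists:
  assumes b: "b \<in> A"
  obtains p where "p \<in> A" "\<And>h. p (p h) = p h" "\<And>h. b (p h) = p (b h)"
    "\<And>h. \<delta> * (norm (p h))\<^sup>2 \<le> rinner (b (p h)) (p h)"
    "\<And>h. p h = 0 \<Longrightarrow> rinner (b h) h \<le> \<delta> * (norm h)\<^sup>2"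
proof -
  define T where "T = (\<lambda>h. b h - \<delta> *\<^sub>R h)"
  have T: "T \<in> A" unfolding T_def by (intro diff_mem scaleR_mem id_mem b)
  obtain R where R: "R \<in> A" "op_pos R" "\<And>h. R (R h) = T (T h)" "\<And>h. T (R h) = R (T h)"
    using abs_exists[OF T] by blast
  define N where "N = (\<lambda>h. R h - T h)"
  have N: "N \<in> A" unfolding N_def by (intro diff_mem R T)
  obtain p where p: "p \<in> A" "\<And>h. p (p h) = p h" "\<And>h. N (p h) = 0" "\<And>h. N h = 0 \<Longrightarrow> p h = h"
    and comm: "\<And>d h. d \<in> A \<Longrightarrow> (\<And>h. d (N h) = N (d h)) \<Longrightarrow> d (p h) = p (d h)"
    using kernel_projection_exists[OF N] by blast
  have Tp: "T (p h) = p (T h)" for h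
    by (rule comm[OF T]) (simp add: N_def apply_diff[OF T] R(4))
  have Rp: "R (p h) = p (R h)" for h
    by (rule comm[OF R(1)]) (simp add: N_def apply_diff[OF R(1)] R(4))
  have "b (p h) = p (b h)" for h
    using Tp[of h] by (simp add: T_def apply_simps[OF p(1)])
  moreover have "\<delta> * (norm (p h))\<^sup>2 \<le> rinner (b (p h)) (p h)" for h
  proof -
    have "0 \<le> rinner (R (p h)) (p h)" using R(2) by (rule op_posD)
    also have "R (p h) = T (p h)" using p(3)[of h] by (simp add: N_def)
    finally show ?thesis by (simp add: T_def rinner_simps rinner_self)
  qed
  moreover have "rinner (b h) h \<le> \<delta> * (norm h)\<^sup>2" if "p h = 0" for h
  proof -
    \<comment> \<open>The product of \<open>R - T\<close> and \<open>R + T\<close> is zero, so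
      \<open>p\<close> fixes \<open>R h + T h\<close>. When \<open>p h = 0\<close> this vector
      vanishes, and \<open>T h = - R h\<close>.\<close>
    have "N (R h + T h) = 0"
      by (simp add: N_def apply_add[OF R(1)] apply_add[OF T] R(3,4))
    then have "R h + T h = p (R h + T h)" using p(4) by simp
    also have "\<dots> = R (p h) + T (p h)" by (simp add: apply_add[OF p(1)] Rp Tp)
    also have "\<dots> = 0" by (simp add: that apply_zero[OF R(1)] apply_zero[OF T])
    finally have "T h = - R h" by (simp add: add_eq_0_iff)
    then have "rinner (T h) h \<le> 0" using op_posD[OF R(2)] by (simp add: rinner_simps)
    then show ?thesis by (simp add: T_def rinner_simps rinner_self)
  qed
  ultimately show thesis
    using that[of p] p(1,2) by blast
qed

text \<open>Write \<open>1 + S = (1 + K) (1 - U)\<close>; then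
  \<open>0 \<le> U \<le> K / (1 + K) < 1\<close>, and the Neumann series for \<open>U\<close> has
  partial sums in \<open>A\<close> with a uniform bound.\<close>

lemma resolvent_exists:
  assumes S: "S \<in> A" "op_pos S"
  obtains B where "B \<in> A" "op_pos B" "\<And>h. B h + S (B h) = h" "\<And>h. B (h + S h) = h"
proof -
  obtain K where K: "0 < K" "\<And>x. norm (S x) \<le> K * norm x"
    using bound_mem[OF S(1)] by blast
  define r where "r = K / (1 + K)"
  have r: "0 \<le> r" "r < 1" using K(1) by (simp_all add: r_def)
  define U where "U = (\<lambda>h. (1 / (1 + K)) *\<^sub>R (K *\<^sub>R h - S h))"
  have U: "U \<in> A" unfolding U_def by (intro scaleR_mem diff_mem id_mem S)
  have U_rinner: "rinner (U h) h = (K * (norm h)\<^sup>2 - rinner (S h) h) / (1 + K)" for h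
    by (simp add: U_def rinner_simps rinner_self)
  have "op_pos U"
    using K(1) rinner_le_of_norm_le[where a = S, OF K(2)] by (simp add: op_pos_iff U_rinner)
  moreover have "rinner (U h) h \<le> r * (norm h)\<^sup>2" for h
    using K(1) op_posD[OF S(2), of h] by (simp add: U_rinner r_def divide_right_mono)
  ultimately have U_norm: "norm (U h) \<le> r * norm h" for h
    using norm_positive_le_of_bound[OF self_adjoint_mem[OF U]] r(1) by blast
  have pow: "norm ((U ^^ i) h) \<le> r ^ i * norm h" for i h
  proof (induction i)
    case (Suc i)
    have "norm ((U ^^ Suc i) h) \<le> r * norm ((U ^^ i) h)" using U_norm by simp
    also have "\<dots> \<le> r * (r ^ i * norm h)" using Suc r(1) by (rule mult_left_mono)
    finally show ?case by (simp add: mult.assoc)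
  qed simp
  have sr: "summable (\<lambda>i. r ^ i)" using r by (simp add: summable_geometric)
  define P where "P n = (\<lambda>h. \<Sum>i<n. (U ^^ i) h)" for n
  define G where "G = (\<lambda>h. \<Sum>i. (U ^^ i) h)"
  have "summable (\<lambda>i. (U ^^ i) h)" for h
    by (rule summable_comparison_test'[where g = "\<lambda>i. r ^ i * norm h" and N = 0])
      (use sr pow in \<open>auto intro: summable_mult2\<close>)
  then have lim: "(\<lambda>n. P n h) \<longlonglongrightarrow> G h" for h
    unfolding P_def G_def by (rule summable_LIMSEQ)
  have P_mem: "P n \<in> A" for n
    unfolding P_def by (intro sum_mem funpow_mem U)
  have P_norm: "norm (P n h) \<le> (\<Sum>i. r ^ i) * norm h" for n h
  proof -
    have "norm (P n h) \<le> (\<Sum>i<n. r ^ i * norm h)"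
      unfolding P_def by (rule sum_norm_le) (rule pow)
    also have "\<dots> = (\<Sum>i<n. r ^ i) * norm h" by (simp add: sum_distrib_right)
    also have "\<dots> \<le> (\<Sum>i. r ^ i) * norm h"
      using sr r by (intro mult_right_mono sum_le_suminf) auto
    finally show ?thesis .
  qed
  have G: "G \<in> A"
    using strong_limit_mem[of P G] P_mem lim P_norm by blast
  have G_eq: "G h = h + U (G h)" for h
  proof -
    have "P (Suc n) h = h + U (P n h)" for n
      unfolding P_def by (subst sum.lessThan_Suc_shift) (simp add: apply_sum[OF U])
    then have "(\<lambda>n. P (Suc n) h) \<longlonglongrightarrow> h + U (G h)"
      using tendsto_add[OF tendsto_const tendsto_apply[OF U lim[of h]], of h] by simp
    then show ?thesis
      using LIMSEQ_Suc[OF lim[of h]] LIMSEQ_unique by blast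
  qed
  define B where "B = (\<lambda>h. (1 / (1 + K)) *\<^sub>R G h)"
  have B: "B \<in> A" unfolding B_def by (intro scaleR_mem G)
  have eq: "B h + S (B h) = h" for h
  proof -
    have "B h + S (B h) = (1 / (1 + K)) *\<^sub>R ((1 + K) *\<^sub>R G h) - U (G h)"
      using K(1) by (simp add: B_def U_def apply_scaleR[OF S(1)] scaleR_add_left algebra_simps)
    also have "\<dots> = G h - U (G h)" using K(1) by simp
    also have "\<dots> = h" using G_eq[of h] by (metis add_diff_cancel_right')
    finally show ?thesis .
  qed
  have "rinner (B h) h = (norm (B h))\<^sup>2 + rinner (S (B h)) (B h)" for h
  proof -
    have "rinner (B h) h = rinner (B h) (B h + S (B h))" by (simp only: eq)
    then show ?thesis by (simp add: rinner_simps rinner_self rinner_commute)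
  qed
  then have "op_pos B"
    using op_posD[OF S(2)] by (simp add: op_pos_iff)
  \<comment> \<open>The right inverse is also a left inverse because \<open>1 + S\<close> is
    injective: pairing \<open>d + S d = 0\<close> with \<open>d\<close> leaves the squared norm of
    \<open>d\<close> plus a nonnegative term.\<close>
  moreover have "B (h + S h) = h" for h
  proof -
    define d where "d = B (h + S h) - h"
    have "d + S d = 0"
      using eq[of "h + S h"] by (simp add: d_def apply_simps[OF S(1)] algebra_simps)
    then have "(norm d)\<^sup>2 + rinner (S d) d = 0"
      using rinner_add_left[of d "S d" d] by (simp add: rinner_self)
    then have "(norm d)\<^sup>2 \<le> 0"
      using op_posD[OF S(2), of d] by linarith
    then show ?thesis by (simp add: d_def)
  qed
  ultimately show thesis using B eq by (intro that)
qed

end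

section \<open>Sequences and series\<close>

text \<open>Weights of the order of the inverse root of the tail tend to infinity, yet the weighted
  terms are dominated by telescoping differences of roots of tails.\<close>

lemma summable_diverging_weights:
  fixes a :: "nat \<Rightarrow> real"
  assumes nonneg: "\<And>k. 0 \<le> a k" and summable: "summable a"
  obtains w where "\<And>k. 1 \<le> w k" "filterlim w at_top sequentially" "summable (\<lambda>k. w k * a k)"
proof -
  \<comment> \<open>The added geometric terms keep every tail strictly positive.\<close>
  define a' where "a' = (\<lambda>k. a k + (1/2) ^ k)"
  have a'_pos: "0 < a' k" for k
    using nonneg[of k] by (simp add: a'_def add_nonneg_pos)
  have sa': "summable a'"
    unfolding a'_def by (intro summable_add summable summable_geometric) simp
  define r where "r k = suminf a' - (\<Sum>i<k. a' i)" for k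
  have r_pos: "0 < r k" for k
    using sum_less_suminf[OF sa', of k] a'_pos by (simp add: r_def)
  have r_Suc: "r k - r (Suc k) = a' k" for k
    by (simp add: r_def)
  have "r \<longlonglongrightarrow> suminf a' - suminf a'"
    unfolding r_def by (intro tendsto_diff tendsto_const summable_LIMSEQ sa')
  then have sqrt_lim: "(\<lambda>k. sqrt (r k)) \<longlonglongrightarrow> 0"
    using tendsto_real_sqrt by fastforce
  define w where "w k = 1 + 1 / sqrt (r k)" for k
  have "filterlim (\<lambda>k. inverse (sqrt (r k))) at_top sequentially"
    using sqrt_lim r_pos by (intro filterlim_inverse_at_top) auto
  then have "filterlim w at_top sequentially"
    unfolding w_def inverse_eq_divide by (intro filterlim_tendsto_add_at_top[OF tendsto_const])
  moreover have "1 \<le> w k" for k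
    using r_pos[of k] by (simp add: w_def)
  moreover have "summable (\<lambda>k. 1 / sqrt (r k) * a k)"
  proof (rule summable_comparison_test'[where N = 0])
    show "summable (\<lambda>k. 2 * (sqrt (r k) - sqrt (r (Suc k))))"
      by (intro summable_mult telescope_summable') (rule sqrt_lim)
    fix k
    have "r (Suc k) \<le> r k"
      using r_Suc[of k] a'_pos[of k] by simp
    then have sq: "sqrt (r (Suc k)) \<le> sqrt (r k)" by simp
    have "a k \<le> r k - r (Suc k)"
      unfolding r_Suc by (simp add: a'_def)
    also have "\<dots> = (sqrt (r k) + sqrt (r (Suc k))) * (sqrt (r k) - sqrt (r (Suc k)))"
      using r_pos[of k] r_pos[of "Suc k"] by (simp add: algebra_simps)
    also have "\<dots> \<le> (2 * sqrt (r k)) * (sqrt (r k) - sqrt (r (Suc k)))"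
      using sq by (intro mult_right_mono) auto
    finally show "norm (1 / sqrt (r k) * a k) \<le> 2 * (sqrt (r k) - sqrt (r (Suc k)))"
      using r_pos[of k] nonneg[of k] by (simp add: field_simps)
  qed
  from summable_add[OF summable this] have "summable (\<lambda>k. w k * a k)"
    by (simp add: w_def distrib_right)
  ultimately show thesis using that by blast
qed

text \<open>Dominated convergence for series: each \<open>v i / (real k + 1)\<^sup>2\<close>
  vanishes as \<open>k\<close> grows and, since \<open>i \<le> k\<close>, is at most the summable
  \<open>v i / (real i + 1)\<^sup>2\<close>.\<close>

lemma Kronecker_quadratic:
  fixes v :: "nat \<Rightarrow> real"
  assumes nonneg: "\<And>n. 0 \<le> v n" and summable: "summable (\<lambda>n. v n / (real n + 1)\<^sup>2)"
  shows "(\<lambda>k. (\<Sum>i\<le>k. v i) / (real k + 1)\<^sup>2) \<longlonglongrightarrow> 0"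
proof -
  define f where "f i k = (if i \<le> k then v i / (real k + 1)\<^sup>2 else 0)" for i k
  have "(\<lambda>k. v i / (real k + 1)\<^sup>2) \<longlonglongrightarrow> 0" for i
    by real_asymp
  moreover have "norm (f i k) \<le> v i / (real k + 1)\<^sup>2" for i k
    by (simp add: f_def nonneg)
  ultimately have lim: "(\<lambda>k. f i k) \<longlonglongrightarrow> 0" for i
    by (rule Lim_null_comparison[OF always_eventually[OF allI], rotated])
  have "norm (f i k) \<le> v i / (real i + 1)\<^sup>2" for i k
    by (auto simp: f_def nonneg intro!: divide_left_mono power_mono)
  then have "eventually (\<lambda>(i, k). norm (f i k) \<le> v i / (real i + 1)\<^sup>2) (at_top \<times>\<^sub>F sequentially)"
    by (simp add: always_eventually)
  then have "(\<lambda>k. suminf (\<lambda>i. f i k)) \<longlonglongrightarrow> suminf (\<lambda>i. 0)"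
    using tannerys_theorem[of f "\<lambda>_. 0", OF lim _ summable] by simp
  moreover have "suminf (\<lambda>i. f i k) = (\<Sum>i\<le>k. v i) / (real k + 1)\<^sup>2" for k
  proof -
    have "suminf (\<lambda>i. f i k) = (\<Sum>i\<le>k. f i k)"
      by (rule suminf_finite) (auto simp: f_def)
    then show ?thesis by (simp add: f_def sum_divide_distrib)
  qed
  ultimately show ?thesis by simp
qed

lemma Cesaro_mean_tendsto:
  fixes f :: "nat \<Rightarrow> 'a::real_normed_vector"
  assumes "f \<longlonglongrightarrow> l"
  shows "(\<lambda>k. (1 / (real k + 1)) *\<^sub>R (\<Sum>i\<le>k. f i)) \<longlonglongrightarrow> l"
proof -
  have "(\<lambda>k. (\<Sum>i\<le>k. norm (f i - l)) / (real k + 1)) \<longlonglongrightarrow> 0"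
  proof (rule LIMSEQ_I)
    fix e :: real assume e: "0 < e"
    then obtain M where M: "\<And>n. n \<ge> M \<Longrightarrow> norm (f n - l) < e / 2"
      using LIMSEQ_D[OF assms, of "e / 2"] by auto
    define C where "C = (\<Sum>i<M. norm (f i - l))"
    have "(\<lambda>k. C / (real k + 1)) \<longlonglongrightarrow> 0" by real_asymp
    then obtain M' where M': "\<And>k. k \<ge> M' \<Longrightarrow> \<bar>C / (real k + 1)\<bar> < e / 2"
      using e LIMSEQ_D[of "\<lambda>k. C / (real k + 1)" 0 "e / 2"] by auto
    have "norm ((\<Sum>i\<le>k. norm (f i - l)) / (real k + 1) - 0) < e" if k: "k \<ge> max M M'" for k
    proof -
      have "(\<Sum>i\<le>k. norm (f i - l)) = C + (\<Sum>i\<in>{M..k}. norm (f i - l))"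
        unfolding C_def using k by (subst sum.union_disjoint[symmetric]) (auto intro!: sum.cong)
      also have "(\<Sum>i\<in>{M..k}. norm (f i - l)) \<le> (\<Sum>i\<in>{M..k}. e / 2)"
        using M by (intro sum_mono) (auto intro: less_imp_le)
      also have "\<dots> \<le> (real k + 1) * (e / 2)"
        using e by (simp add: of_nat_diff mult_right_mono)
      finally have "(\<Sum>i\<le>k. norm (f i - l)) / (real k + 1) \<le> (C + (real k + 1) * (e / 2)) / (real k + 1)"
        by (intro divide_right_mono) simp_all
      then have "(\<Sum>i\<le>k. norm (f i - l)) / (real k + 1) \<le> C / (real k + 1) + e / 2"
        unfolding add_divide_distrib by (subst (asm) nonzero_mult_div_cancel_left) auto
      moreover have "0 \<le> (\<Sum>i\<le>k. norm (f i - l)) / (real k + 1)"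
        by (simp add: sum_nonneg)
      moreover have "\<bar>C / (real k + 1)\<bar> < e / 2"
        using M' k by simp
      ultimately show ?thesis by (simp only: real_norm_def)
    qed
    then show "\<exists>no. \<forall>k\<ge>no. norm ((\<Sum>i\<le>k. norm (f i - l)) / (real k + 1) - 0) < e"
      by blast
  qed
  moreover have "norm ((1 / (real k + 1)) *\<^sub>R (\<Sum>i\<le>k. f i) - l) \<le> (\<Sum>i\<le>k. norm (f i - l)) / (real k + 1)" for k
  proof -
    have "(1 / (real k + 1)) *\<^sub>R (\<Sum>i\<le>k. f i) - l = (1 / (real k + 1)) *\<^sub>R (\<Sum>i\<le>k. f i - l)"
    proof -
      have "(1 / (real k + 1)) *\<^sub>R (\<Sum>i\<le>k. l) = l"
        unfolding sum_constant_scaleR by (simp add: add.commute)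
      then show ?thesis
        by (simp only: sum_subtractf scaleR_diff_right)
    qed
    then show ?thesis
      using norm_sum[of "\<lambda>i. f i - l" "{..k}"] by (simp add: divide_right_mono)
  qed
  ultimately have "(\<lambda>k. (1 / (real k + 1)) *\<^sub>R (\<Sum>i\<le>k. f i) - l) \<longlonglongrightarrow> 0"
    using Lim_null_comparison always_eventually by (metis (mono_tags, lifting))
  then show ?thesis by (rule LIM_zero_cancel)
qed

text \<open>Provides one scalar for all vectors at once. A single nonzero \<open>h\<close> with
  \<open>c k *\<^sub>R h\<close> convergent forces \<open>c\<close> to converge; otherwise the
  premise can hold only at \<open>h = 0\<close>.\<close>

lemma scalar_multiplier_of_limits:
  fixes f :: "'a::real_normed_vector \<Rightarrow> 'a" and c :: "nat \<Rightarrow> real"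
  assumes "f 0 = 0"
  obtains \<gamma> where "\<And>h. (\<lambda>k. c k *\<^sub>R h) \<longlonglongrightarrow> f h \<Longrightarrow> f h = \<gamma> *\<^sub>R h"
proof -
  have "f h = lim c *\<^sub>R h" if lim: "(\<lambda>k. c k *\<^sub>R h) \<longlonglongrightarrow> f h" for h
  proof (cases "h = 0")
    case False
    have "Cauchy (\<lambda>k. c k *\<^sub>R h)"
      using lim LIMSEQ_imp_Cauchy by blast
    have "Cauchy c"
    proof (rule metric_CauchyI)
      fix e :: real assume "0 < e"
      then have "0 < e * norm h" using False by simp
      then obtain M where M: "\<forall>m\<ge>M. \<forall>n\<ge>M. dist (c m *\<^sub>R h) (c n *\<^sub>R h) < e * norm h"
        using metric_CauchyD[OF \<open>Cauchy (\<lambda>k. c k *\<^sub>R h)\<close>] by blast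
      have "dist (c m) (c n) < e" if "m \<ge> M" "n \<ge> M" for m n
      proof -
        have "\<bar>c m - c n\<bar> * norm h < e * norm h"
          using M that by (simp add: dist_norm flip: scaleR_diff_left)
        then show ?thesis using False by (simp add: dist_real_def)
      qed
      then show "\<exists>M. \<forall>m\<ge>M. \<forall>n\<ge>M. dist (c m) (c n) < e" by blast
    qed
    then have "c \<longlonglongrightarrow> lim c"
      by (simp add: Cauchy_convergent convergent_LIMSEQ_iff[symmetric])
    then have "(\<lambda>k. c k *\<^sub>R h) \<longlonglongrightarrow> lim c *\<^sub>R h"
      by (intro tendsto_intros)
    then show ?thesis using lim LIMSEQ_unique by blast
  qed (simp add: assms)
  then show thesis by (rule that)
qed

section \<open>Compressions and bundles\<close>

context jw_algebra
begin

lemma resolvent_le_identity: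
  assumes S: "S \<in> A" "op_pos S" and B: "B \<in> A" "\<And>h. B h + S (B h) = h"
  shows "rinner (B h) h \<le> (norm h)\<^sup>2"
proof -
  have "rinner (B h) h = (norm (B h))\<^sup>2 + rinner (S (B h)) (B h)"
    using rinner_add_right[of "B h" "B h" "S (B h)"] B(2)[of h]
    by (simp add: rinner_self rinner_commute)
  then have "norm (B h) * norm (B h) \<le> norm (B h) * norm h"
    using op_posD[OF S(2), of "B h"] abs_rinner_le[of "B h" h] by (simp add: power2_eq_square)
  then have "norm (B h) \<le> 1 * norm h"
    by (cases "B h = 0") auto
  then show ?thesis
    using rinner_le_of_norm_le[where a = B and K = 1 and x = h] by simp
qed

text \<open>The operator form of \<open>1 - s \<le> 1 / (1 + s)\<close>: use positivity of
  \<open>1 + S\<close> at \<open>h - B h\<close>, which \<open>1 + S\<close> maps to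
  \<open>S h\<close>.\<close>

lemma resolvent_ge:
  assumes S: "S \<in> A" "op_pos S" and B: "B \<in> A" "\<And>h. B h + S (B h) = h"
  shows "(norm h)\<^sup>2 - rinner (S h) h \<le> rinner (B h) h"
proof -
  define k where "k = B h"
  have k: "S k = h - k" using B(2)[of h] by (metis k_def add_diff_cancel_left')
  have "0 \<le> (norm (h - k))\<^sup>2 + rinner (S (h - k)) (h - k)"
    using op_posD[OF S(2)] by simp
  also have "\<dots> = rinner ((h - k) + (S h - S k)) (h - k)"
    by (simp add: rinner_add_left rinner_self apply_diff[OF S(1)])
  also have "\<dots> = rinner (S h) h - rinner h (S k)"
    by (simp add: k rinner_diff_right apply_rinner[OF S(1)])
  also have "rinner h (S k) = (norm h)\<^sup>2 - rinner h k"
    by (simp add: k rinner_diff_right rinner_self)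
  also have "rinner h k = rinner (B h) h"
    by (simp add: k_def rinner_commute)
  finally show ?thesis by simp
qed

text \<open>No commutation is available, so Cauchy-Schwarz for the form of \<open>1 + S1\<close> is
  applied at \<open>B1 h\<close> and \<open>B2 h\<close>, and a common factor is cancelled.\<close>

lemma resolvent_antimono:
  assumes S1: "S1 \<in> A" "op_pos S1" and S2: "S2 \<in> A"
    and B1: "\<And>h. B1 h + S1 (B1 h) = h" and B2: "\<And>h. B2 h + S2 (B2 h) = h"
    and le: "\<And>h. rinner (S1 h) h \<le> rinner (S2 h) h"
  shows "rinner (B2 h) h \<le> rinner (B1 h) h"
proof -
  define T where "T = (\<lambda>h. h + S1 h)"
  have T: "T \<in> A" unfolding T_def by (intro add_mem id_mem S1)
  have T_pos: "op_pos T"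
    using op_posD[OF S1(2)] by (simp add: op_pos_iff T_def rinner_add_left rinner_self)
  have TB: "T (B1 h) = h" using B1 by (simp add: T_def)
  have Tle: "rinner (T (B2 h)) (B2 h) \<le> rinner h (B2 h)"
    using le[of "B2 h"] rinner_add_left[of "B2 h" "S2 (B2 h)" "B2 h"] B2[of h]
    by (simp add: T_def rinner_add_left)
  have nn: "0 \<le> rinner h (B2 h)" "0 \<le> rinner h (B1 h)"
    using op_posD[OF T_pos, of "B2 h"] Tle op_posD[OF T_pos, of "B1 h"] by (simp_all add: TB)
  have "(rinner (T (B1 h)) (B2 h))\<^sup>2 \<le> rinner (T (B1 h)) (B1 h) * rinner (T (B2 h)) (B2 h)"
    by (rule positive_Cauchy_Schwarz[OF self_adjoint_mem[OF T] T_pos])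
  also have "\<dots> \<le> rinner h (B1 h) * rinner h (B2 h)"
    using Tle nn by (simp add: TB mult_left_mono)
  finally have "rinner h (B2 h) * rinner h (B2 h) \<le> rinner h (B1 h) * rinner h (B2 h)"
    by (simp add: TB power2_eq_square)
  then have "rinner h (B2 h) \<le> rinner h (B1 h)"
    using nn by (cases "rinner h (B2 h) = 0") auto
  then show ?thesis by (simp add: rinner_commute)
qed

lemma norm_projection_le:
  assumes p: "p \<in> A" "\<And>h. p (p h) = p h"
  shows "norm (p h) \<le> norm h" and "norm (h - p h) \<le> norm h"
proof -
  have *: "rinner (p h) h = (norm (p h))\<^sup>2"
    by (metis apply_rinner p rinner_self)
  then have "(norm (p h))\<^sup>2 + (norm (h - p h))\<^sup>2 = (norm h)\<^sup>2"
    using rinner_commute[of h "p h"] by (simp add: rinner_diff_left rinner_diff_right flip: rinner_self)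
  then have "(norm (p h))\<^sup>2 \<le> (norm h)\<^sup>2" "(norm (h - p h))\<^sup>2 \<le> (norm h)\<^sup>2"
    using zero_le_power2[of "norm (p h)"] zero_le_power2[of "norm (h - p h)"] by linarith+
  then show "norm (p h) \<le> norm h" "norm (h - p h) \<le> norm h"
    using norm_ge_zero power2_le_imp_le by blast+
qed

text \<open>Cauchy-Schwarz for \<open>S\<close> between \<open>p x\<close> and
  \<open>p (S (p x))\<close>, both in the range of \<open>p\<close>, where the form bound
  holds.\<close>

lemma compression_norm_le:
  assumes S: "S \<in> A" "op_pos S" and p: "p \<in> A" "\<And>h. p (p h) = p h"
    and le: "\<And>y. rinner (S (p y)) (p y) \<le> C * (norm (p y))\<^sup>2" and C: "0 \<le> C"
  shows "norm (p (S (p x))) \<le> C * norm x"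
proof -
  define z where "z = p (S (p x))"
  have pz: "p z = z" by (simp add: z_def p(2))
  have "(norm z)\<^sup>2 = rinner (S (p x)) z"
    by (metis apply_rinner p(1) pz rinner_self z_def)
  then have "((norm z)\<^sup>2)\<^sup>2 \<le> rinner (S (p x)) (p x) * rinner (S z) z"
    using positive_Cauchy_Schwarz[OF self_adjoint_mem[OF S(1)] S(2), of "p x" z] by simp
  also have "\<dots> \<le> (C * (norm (p x))\<^sup>2) * (C * (norm z)\<^sup>2)"
    using le[of x] le[of z] C op_posD[OF S(2)] by (intro mult_mono) (auto simp: pz)
  also have "\<dots> = (C * norm (p x))\<^sup>2 * (norm z)\<^sup>2"
    by (simp add: power2_eq_square)
  finally have "(norm z)\<^sup>2 \<le> (C * norm (p x))\<^sup>2"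
    by (cases "z = 0") (simp_all add: power2_eq_square)
  then have "norm z \<le> C * norm (p x)"
    by (rule power2_le_imp_le) (simp add: C)
  also have "\<dots> \<le> C * norm x"
    using norm_projection_le(1)[OF p] C by (rule mult_left_mono)
  finally show ?thesis by (simp add: z_def)
qed

text \<open>Inverting an inequality \<open>b \<le> (1 + S)\<^sup>-\<^sup>1\<close> under a compression requires \<open>p\<close> to commute
  with \<open>b\<close>; the hypothesis is that inequality, evaluated at \<open>v + S v\<close>.\<close>
lemma compression_le:
  assumes S: "S \<in> A" and b: "b \<in> A" "op_pos b"
    and le: "\<And>v. rinner (b (v + S v)) (v + S v) \<le> rinner v (v + S v)"
    and p: "p \<in> A" "\<And>h. p (p h) = p h" "\<And>h. b (p h) = p (b h)"
    and ge: "\<And>h. \<delta> * (norm (p h))\<^sup>2 \<le> rinner (b (p h)) (p h)" and \<delta>: "0 < \<delta>"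
  shows "rinner (S (p y)) (p y) \<le> (1 / \<delta>) * (norm (p y))\<^sup>2"
proof -
  define v where "v = p y + S (p y)"
  \<comment> \<open>Commutation with \<open>p\<close> removes the cross terms. The complementary
    term is nonnegative, so \<open>b\<close> at \<open>v\<close> is bounded below by its
    compression.\<close>
  have "rinner (b v) v = rinner (b (p v)) (p v) + rinner (b (v - p v)) (v - p v)"
  proof -
    have "rinner (b (p v)) v = rinner (b (p v)) (p v)" "rinner (b v) (p v) = rinner (b (p v)) (p v)"
      by (metis apply_rinner p)+
    then show ?thesis by (simp add: apply_diff[OF b(1)] rinner_diff_left rinner_diff_right)
  qed
  then have "\<delta> * (norm (p v))\<^sup>2 \<le> rinner (b v) v"
    using ge[of v] op_posD[OF b(2), of "v - p v"] by linarith
  also have "\<dots> \<le> rinner (p y) v"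
    using le[of "p y"] by (simp add: v_def)
  also have yv: "rinner (p y) v = rinner (p y) (p v)"
    by (metis apply_rinner p(1,2))
  also have yv_le: "\<dots> \<le> norm (p y) * norm (p v)"
    using abs_rinner_le[of "p y" "p v"] by simp
  finally have "\<delta> * norm (p v) \<le> norm (p y)"
    by (cases "p v = 0") (simp_all add: power2_eq_square)
  then have "norm (p v) \<le> norm (p y) / \<delta>"
    using \<delta> by (simp add: field_simps)
  then have "norm (p y) * norm (p v) \<le> norm (p y) * (norm (p y) / \<delta>)"
    by (rule mult_left_mono) simp
  moreover have "rinner (S (p y)) (p y) \<le> rinner (p y) v"
    by (simp add: v_def rinner_add_right rinner_self rinner_commute)
  ultimately show ?thesis
    using yv yv_le by (simp add: power2_eq_square)
qed

text \<open>\<open>w k \<ge> 1\<close> bounds the compressed partial sums by \<open>C\<close>, while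
  isolating one summand bounds the compression of \<open>D k\<close> by \<open>C / w k\<close>,
  which tends to zero.\<close>

lemma proj_bundle_memI:
  assumes D: "\<And>k. D k \<in> A" "\<And>k. op_pos (D k)"
    and p: "p \<in> A" "\<And>h. p (p h) = p h" "p \<noteq> zero_op"
    and w: "\<And>k. 1 \<le> w k" "filterlim w at_top sequentially"
    and le: "\<And>m y. (\<Sum>k\<le>m. w k * rinner (D k (p y)) (p y)) \<le> C * (norm (p y))\<^sup>2" and C: "0 \<le> C"
  shows "p \<in> proj_bundle A D"
proof -
  have term_nonneg: "0 \<le> w k * rinner (D k h) h" for k h
    using w(1)[of k] op_posD[OF D(2)] by simp
  have S_rinner: "rinner (\<Sum>k\<le>m. D k h) h = (\<Sum>k\<le>m. rinner (D k h) h)" for m h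
    by (induction m) (simp_all add: rinner_add_left)
  have "opnorm (p \<circ> (\<lambda>h. \<Sum>k\<le>m. D k h) \<circ> p) \<le> C" for m
  proof -
    have "(\<lambda>h. \<Sum>k\<le>m. D k h) \<in> A"
      by (intro sum_mem D)
    moreover have "rinner (\<Sum>k\<le>m. D k (p y)) (p y) \<le> C * (norm (p y))\<^sup>2" for y
    proof -
      have "(\<Sum>k\<le>m. rinner (D k (p y)) (p y)) \<le> (\<Sum>k\<le>m. w k * rinner (D k (p y)) (p y))"
        using w(1) op_posD[OF D(2)] by (intro sum_mono) (metis mult_right_mono mult_1)
      then show ?thesis using le[where m = m and y = y] by (simp add: S_rinner)
    qed
    moreover have "op_pos (\<lambda>h. \<Sum>k\<le>m. D k h)"
      using op_posD[OF D(2)] by (simp add: op_pos_iff S_rinner sum_nonneg)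
    ultimately have "norm (p (\<Sum>k\<le>m. D k (p x))) \<le> C * norm x" for x
      using compression_norm_le[of "\<lambda>h. \<Sum>k\<le>m. D k h" p C x] p C by blast
    then show ?thesis
      unfolding opnorm_def comp_def using C by (intro onorm_bound) auto
  qed
  then have "bdd_above (range (\<lambda>m. opnorm (p \<circ> (\<lambda>h. \<Sum>k\<le>m. D k h) \<circ> p)))"
    by (intro bdd_aboveI2)
  moreover have "(\<lambda>k. opnorm (p \<circ> D k \<circ> p)) \<longlonglongrightarrow> 0"
  proof (rule tendsto_sandwich[OF _ _ tendsto_const])
    have "filterlim (\<lambda>k. inverse (w k)) (nhds 0) sequentially"
      using w(2) by (rule tendsto_inverse_0_at_top)
    then show "(\<lambda>k. C * inverse (w k)) \<longlonglongrightarrow> 0"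
      by (rule tendsto_mult_right_zero)
    show "\<forall>\<^sub>F k in sequentially. 0 \<le> opnorm (p \<circ> D k \<circ> p)"
      unfolding opnorm_def comp_def
      by (intro always_eventually allI onorm_pos_le bounded_linear_compose[OF bounded_linear_mem[OF p(1)]]
          bounded_linear_compose[OF bounded_linear_mem[OF D(1)]] bounded_linear_mem[OF p(1)])
    have "norm (p (D k (p h))) \<le> (C * inverse (w k)) * norm h" for k h
    proof (rule compression_norm_le[OF D p(1,2)])
      fix y
      have "w k * rinner (D k (p y)) (p y) \<le> (\<Sum>j\<le>k. w j * rinner (D j (p y)) (p y))"
        by (rule member_le_sum) (simp_all add: term_nonneg)
      then have "w k * rinner (D k (p y)) (p y) \<le> C * (norm (p y))\<^sup>2"
        using le[where m = k and y = y] by linarith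
      then show "rinner (D k (p y)) (p y) \<le> C * inverse (w k) * (norm (p y))\<^sup>2"
        using w(1)[of k] by (simp add: field_simps)
    qed (use C w(1)[of k] in simp)
    moreover have "0 \<le> C * inverse (w k)" for k
      using C w(1)[of k] by simp
    ultimately show "\<forall>\<^sub>F k in sequentially. opnorm (p \<circ> D k \<circ> p) \<le> C * inverse (w k)"
      unfolding opnorm_def comp_def by (intro always_eventually allI onorm_bound) auto
  qed
  moreover have "p \<circ> p = p" using p(2) by auto
  ultimately show ?thesis
    using p(1,3) by (simp add: proj_bundle_def is_projection_def)
qed

text \<open>The squared norm of \<open>d n (p y)\<close> is the form of the compressed square at
  \<open>y\<close>, so norm convergence becomes pointwise convergence.\<close>

lemma compression_tendsto:
  assumes d: "\<And>n. d n \<in> A" and p: "p \<in> A"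
    and lim: "(\<lambda>n. opnorm (p \<circ> (d n \<circ> d n) \<circ> p)) \<longlonglongrightarrow> 0"
  shows "(\<lambda>n. d n (p y)) \<longlonglongrightarrow> 0"
proof -
  have "(norm (d n (p y)))\<^sup>2 \<le> opnorm (p \<circ> (d n \<circ> d n) \<circ> p) * (norm y)\<^sup>2" for n
  proof -
    have bl: "bounded_linear (\<lambda>y. p (d n (d n (p y))))"
      by (intro bounded_linear_compose[OF bounded_linear_mem[OF p]]
          bounded_linear_compose[OF bounded_linear_mem[OF d]] bounded_linear_mem p)
    have "(norm (d n (p y)))\<^sup>2 = rinner (p (d n (d n (p y)))) y"
      by (simp add: apply_rinner[OF p] apply_rinner[OF d] flip: rinner_self)
    also have "\<dots> \<le> onorm (\<lambda>y. p (d n (d n (p y)))) * (norm y)\<^sup>2"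
      by (rule rinner_le_of_norm_le) (rule onorm[OF bl])
    finally show ?thesis by (simp add: opnorm_def comp_def)
  qed
  then have "norm ((norm (d n (p y)))\<^sup>2) \<le> opnorm (p \<circ> (d n \<circ> d n) \<circ> p) * (norm y)\<^sup>2" for n
    by simp
  moreover have "(\<lambda>n. opnorm (p \<circ> (d n \<circ> d n) \<circ> p) * (norm y)\<^sup>2) \<longlonglongrightarrow> 0"
    by (rule tendsto_mult_left_zero[OF lim])
  ultimately have "(\<lambda>n. (norm (d n (p y)))\<^sup>2) \<longlonglongrightarrow> 0"
    by (rule Lim_null_comparison[OF always_eventually[OF allI]])
  then have "(\<lambda>n. sqrt ((norm (d n (p y)))\<^sup>2)) \<longlonglongrightarrow> sqrt 0"
    by (rule tendsto_real_sqrt)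
  then show ?thesis by (simp add: tendsto_norm_zero_iff)
qed

end

section \<open>Normal states and bounded compressions\<close>

locale jw_state = jw_algebra A for A :: "('a::complex_hilbert \<Rightarrow> 'a) set" +
  fixes \<rho> :: "('a \<Rightarrow> 'a) \<Rightarrow> real"
  assumes state: "is_state A \<rho>" and faithful: "faithful_state A \<rho>" and normal: "normal_state A \<rho>"
begin

section \<open>The state as a monotone linear functional, and its continuity along increasing
  sequences\<close>

lemma rho_add: "a \<in> A \<Longrightarrow> b \<in> A \<Longrightarrow> \<rho> (\<lambda>h. a h + b h) = \<rho> a + \<rho> b"
  using state by (simp add: is_state_def op_add_def)

lemma rho_scaleR: "a \<in> A \<Longrightarrow> \<rho> (\<lambda>h. r *\<^sub>R a h) = r * \<rho> a"
  using state by (simp add: is_state_def op_scaleR_def)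

lemma rho_diff: "a \<in> A \<Longrightarrow> b \<in> A \<Longrightarrow> \<rho> (\<lambda>h. a h - b h) = \<rho> a - \<rho> b"
  using rho_add[of a "\<lambda>h. (-1) *\<^sub>R b h"] scaleR_mem[of b "-1"] rho_scaleR[of b "-1"] by simp

lemma rho_id: "\<rho> (\<lambda>h. h) = 1"
  using state by (simp add: is_state_def id_def)

lemma rho_zero: "\<rho> (\<lambda>h. 0) = 0"
  using rho_scaleR[OF id_mem, of 0] by simp

lemma rho_sum:
  assumes "\<And>i. i \<in> I \<Longrightarrow> f i \<in> A"
  shows "\<rho> (\<lambda>h. \<Sum>i\<in>I. f i h) = (\<Sum>i\<in>I. \<rho> (f i))"
  using assms
  by (induction I rule: infinite_finite_induct) (auto simp: rho_zero rho_add sum_mem)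

lemma rho_nonneg: "a \<in> A \<Longrightarrow> op_pos a \<Longrightarrow> 0 \<le> \<rho> a"
  using state by (simp add: is_state_def)

lemma rho_mono:
  assumes "a \<in> A" "b \<in> A" "\<And>h. rinner (a h) h \<le> rinner (b h) h"
  shows "\<rho> a \<le> \<rho> b"
proof -
  have "op_pos (\<lambda>h. b h - a h)"
    using assms(3) by (simp add: op_pos_iff rinner_diff_left)
  then have "0 \<le> \<rho> (\<lambda>h. b h - a h)"
    by (intro rho_nonneg diff_mem assms)
  then show ?thesis
    by (simp add: rho_diff assms)
qed

lemma square_pos: "a \<in> A \<Longrightarrow> op_pos (\<lambda>h. a (a h))"
  by (simp add: op_pos_iff apply_rinner rinner_self)

lemma rho_square_nonneg: "a \<in> A \<Longrightarrow> 0 \<le> \<rho> (\<lambda>h. a (a h))"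
  by (intro rho_nonneg square_mem square_pos)

text \<open>The range of an increasing sequence is directed and its strong limit is its least upper
  bound in \<open>A\<close>, so normality applies.\<close>

lemma rho_strong_limit_le:
  assumes mem: "\<And>n. a n \<in> A" "T \<in> A"
    and mono: "\<And>n h. rinner (a n h) h \<le> rinner (a (Suc n) h) h"
    and lim: "\<And>h. (\<lambda>n. a n h) \<longlonglongrightarrow> T h" and le: "\<And>n. \<rho> (a n) \<le> \<epsilon>"
  shows "\<rho> T \<le> \<epsilon>"
proof -
  have inc: "incseq (\<lambda>n. rinner (a n h) h)" for h
    by (rule incseq_SucI) (rule mono)
  have lim_r: "(\<lambda>n. rinner (a n h) h) \<longlonglongrightarrow> rinner (T h) h" for h
    by (rule bounded_linear.tendsto[OF bounded_linear_rinner_left lim])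
  have "op_le (a n) T" for n
    using incseq_le[OF inc lim_r] by (simp add: op_le_iff)
  moreover have "op_le T b" if "\<forall>n. op_le (a n) b" for b
    using LIMSEQ_le_const2[OF lim_r] that by (simp add: op_le_iff)
  moreover have "\<exists>k. op_le (a m) (a k) \<and> op_le (a n) (a k)" for m n
    using incseqD[OF inc] by (intro exI[of _ "max m n"]) (simp add: op_le_iff)
  ultimately have "range a \<subseteq> A \<and> range a \<noteq> {} \<and>
      (\<forall>c\<in>range a. \<forall>d\<in>range a. \<exists>k\<in>range a. op_le c k \<and> op_le d k) \<and>
      T \<in> A \<and> (\<forall>c\<in>range a. op_le c T) \<and> (\<forall>b\<in>A. (\<forall>c\<in>range a. op_le c b) \<longrightarrow> op_le T b)"
    using mem by simp blast
  then have "\<rho> T = (SUP x\<in>range a. \<rho> x)"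
    using normal unfolding normal_state_def by blast
  also have "\<dots> \<le> \<epsilon>"
    using le by (intro cSUP_least) auto
  finally show ?thesis .
qed

text \<open>The operator \<open>b\<close> is the infimum of the decreasing sequence \<open>(1 + S\<^sub>n)\<^sup>-\<^sup>1\<close>.\<close>
lemma resolvent_infimum_exists:
  assumes S: "\<And>n. S n \<in> A" "\<And>n. op_pos (S n)"
    and mono: "\<And>n h. rinner (S n h) h \<le> rinner (S (Suc n) h) h"
    and le: "\<And>n. \<rho> (S n) \<le> \<epsilon>"
  obtains b where "b \<in> A" "op_pos b" "\<And>h. rinner (b h) h \<le> (norm h)\<^sup>2"
    "\<rho> (\<lambda>h. h - b h) \<le> \<epsilon>"
    "\<And>n v. rinner (b (v + S n v)) (v + S n v) \<le> rinner v (v + S n v)"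
proof -
  have "\<exists>B. B \<in> A \<and> op_pos B \<and> (\<forall>h. B h + S n (B h) = h) \<and> (\<forall>h. B (h + S n h) = h)" for n
    using resolvent_exists[OF S] by metis
  then obtain B where B: "\<And>n. B n \<in> A" "\<And>n. op_pos (B n)"
    "\<And>n h. B n h + S n (B n h) = h" "\<And>n h. B n (h + S n h) = h"
    by metis
  \<comment> \<open>The complements of the resolvents increase, as the monotone limit requires, and
    \<open>resolvent_ge\<close> bounds their state by that of \<open>S n\<close>.\<close>
  define a where "a n = (\<lambda>h. h - B n h)" for n
  have a_mem: "a n \<in> A" for n
    unfolding a_def by (intro diff_mem id_mem B)
  have a_rinner: "rinner (a n h) h = (norm h)\<^sup>2 - rinner (B n h) h" for n h
    by (simp add: a_def rinner_diff_left rinner_self)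
  have a_mono: "rinner (a n h) h \<le> rinner (a (Suc n) h) h" for n h
    using resolvent_antimono[OF S(1)[of n] S(2)[of n] S(1)[of "Suc n"] B(3)[of n] B(3)[of "Suc n"] mono[of n], of h]
    by (simp add: a_rinner)
  have a_pos: "0 \<le> rinner (a n h) h" for n h
    using resolvent_le_identity[OF S B(1,3)] by (simp add: a_rinner)
  have a_le: "rinner (a n h) h \<le> 1 * (norm h)\<^sup>2" for n h
    using op_posD[OF B(2)] by (simp add: a_rinner)
  have "\<rho> (a n) \<le> \<rho> (S n)" for n
    using resolvent_ge[OF S B(1,3), of _ n] by (intro rho_mono a_mem S) (simp add: a_rinner algebra_simps)
  then have a_rho: "\<rho> (a n) \<le> \<epsilon>" for n
    using le order.trans by blast
  obtain T where T: "T \<in> A" "\<And>h. (\<lambda>n. a n h) \<longlonglongrightarrow> T h"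
    using monotone_limit[of a 1, OF a_mem a_mono a_pos a_le zero_le_one] by blast
  have lim_r: "(\<lambda>n. rinner (a n h) h) \<longlonglongrightarrow> rinner (T h) h" for h
    by (rule bounded_linear.tendsto[OF bounded_linear_rinner_left T(2)])
  have a_le_T: "rinner (a n h) h \<le> rinner (T h) h" for n h
    by (rule incseq_le[OF incseq_SucI lim_r]) (rule a_mono)
  define b where "b = (\<lambda>h. h - T h)"
  have b_rinner: "rinner (b h) h = (norm h)\<^sup>2 - rinner (T h) h" for h
    by (simp add: b_def rinner_diff_left rinner_self)
  have "b \<in> A" unfolding b_def by (intro diff_mem id_mem T)
  moreover have "op_pos b"
    using LIMSEQ_le_const2[OF lim_r] a_le by (simp add: op_pos_iff b_rinner)
  moreover have "rinner (b h) h \<le> (norm h)\<^sup>2" for h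
    using a_le_T[of 0 h] a_pos[of 0 h] by (simp add: b_rinner)
  moreover have "\<rho> (\<lambda>h. h - b h) \<le> \<epsilon>"
    using rho_strong_limit_le[OF a_mem T(1) a_mono T(2) a_rho] by (simp add: b_def)
  \<comment> \<open>Since \<open>B n (v + S n v) = v\<close>, the relation
    \<open>b \<le> B n\<close> takes a form free of the resolvent.\<close>
  moreover have "rinner (b (v + S n v)) (v + S n v) \<le> rinner v (v + S n v)" for n v
    using a_le_T[of n "v + S n v"] a_rinner[of n "v + S n v"] b_rinner[of "v + S n v"] B(4)[of n v]
    by simp
  ultimately show thesis by (rule that)
qed

text \<open>For every \<open>t > 0\<close> the spectral projections of the infimum \<open>b\<close> of
  \<open>(1 + t \<Sum>\<^sub>k\<^sub>\<le>\<^sub>m F\<^sub>k)\<^sup>-\<^sup>1\<close> compress \<open>\<Sum>F\<^sub>k\<close> to a bounded operator, so \<open>e b = 0\<close>. Hence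
  \<open>e\<^sup>2 = (1 - b) e\<^sup>2 (1 - b) \<le> K\<^sup>2 (1 - b)\<close>, while \<open>\<rho> (1 - b) = O(t)\<close>.\<close>
lemma eq_zero_if_zero_on_compressions:
  fixes F :: "nat \<Rightarrow> 'a \<Rightarrow> 'a"
  assumes F: "\<And>k. F k \<in> A" "\<And>k. op_pos (F k)" and M: "\<And>m. (\<Sum>k\<le>m. \<rho> (F k)) \<le> M"
    and e: "e \<in> A"
    and zero: "\<And>p C y. p \<in> A \<Longrightarrow> (\<And>h. p (p h) = p h) \<Longrightarrow> 0 \<le> C \<Longrightarrow>
      (\<And>m y. (\<Sum>k\<le>m. rinner (F k (p y)) (p y)) \<le> C * (norm (p y))\<^sup>2) \<Longrightarrow> e (p y) = 0"
  shows "e h = 0"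
proof -
  obtain K where K: "0 < K" "\<And>x. norm (e x) \<le> K * norm x"
    using bound_mem[OF e] by blast
  have rho_le: "\<rho> (\<lambda>h. e (e h)) \<le> K\<^sup>2 * (t * M)" if t: "0 < t" for t
  proof -
    define S where "S m = (\<lambda>h. t *\<^sub>R (\<Sum>k\<le>m. F k h))" for m
    have S_mem: "S m \<in> A" for m
      unfolding S_def by (intro scaleR_mem sum_mem F)
    have S_rinner: "rinner (S m h) h = t * (\<Sum>k\<le>m. rinner (F k h) h)" for m h
      unfolding S_def rinner_scaleR_left by (induction m) (simp_all add: rinner_add_left)
    have S_pos: "op_pos (S m)" for m
      using t op_posD[OF F(2)] by (simp add: op_pos_iff S_rinner sum_nonneg)
    have S_mono: "rinner (S m h) h \<le> rinner (S (Suc m) h) h" for m h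
      using t op_posD[OF F(2)] by (simp add: S_rinner)
    have "\<rho> (S m) = t * (\<Sum>k\<le>m. \<rho> (F k))" for m
      unfolding S_def by (simp add: rho_scaleR rho_sum sum_mem F)
    then have S_rho: "\<rho> (S m) \<le> t * M" for m
      using M t by simp
    obtain b where b: "b \<in> A" "op_pos b" and b_le: "\<And>h. rinner (b h) h \<le> (norm h)\<^sup>2"
      and b_rho: "\<rho> (\<lambda>h. h - b h) \<le> t * M"
      and b_S: "\<And>n v. rinner (b (v + S n v)) (v + S n v) \<le> rinner v (v + S n v)"
      using resolvent_infimum_exists[of S, OF S_mem S_pos S_mono S_rho] by blast
    have eb_le: "norm (e (b v)) \<le> K * (\<delta> * norm v)" if \<delta>: "0 < \<delta>" for \<delta> v
    proof -
      obtain p where p: "p \<in> A" "\<And>h. p (p h) = p h" "\<And>h. b (p h) = p (b h)"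
        and ge: "\<And>h. \<delta> * (norm (p h))\<^sup>2 \<le> rinner (b (p h)) (p h)"
        and le: "\<And>h. p h = 0 \<Longrightarrow> rinner (b h) h \<le> \<delta> * (norm h)\<^sup>2"
        using spectral_projection_exists[OF b(1), of \<delta>] by blast
      \<comment> \<open>The compression bound for \<open>S m\<close> is \<open>1 / \<delta>\<close>;
        dividing by the factor \<open>t\<close> in \<open>S m\<close> gives the constant.\<close>
      have "(\<Sum>k\<le>m. rinner (F k (p y)) (p y)) \<le> (1 / (t * \<delta>)) * (norm (p y))\<^sup>2" for m y
        using compression_le[OF S_mem b b_S p ge \<delta>, of m y] t \<delta>
        by (simp add: S_rinner field_simps)
      then have ep: "e (p y) = 0" for y
        using zero[OF p(1,2), of "1 / (t * \<delta>)"] t \<delta> by simp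
      define z where "z = v - p v"
      have pz: "p z = 0" by (simp add: z_def apply_diff[OF p(1)] p(2))
      have pbz: "p (b z) = 0" by (simp add: pz apply_zero[OF b(1)] flip: p(3))
      \<comment> \<open>Both \<open>z\<close> and \<open>b z\<close> lie in the kernel of
        \<open>p\<close>, where the form of \<open>b\<close> is at most
        \<open>\<delta>\<close>.\<close>
      have "(norm (b z))\<^sup>2 \<le> \<delta> * rinner (b z) z"
        by (rule norm_positive_le[OF self_adjoint_mem[OF b(1)] b(2) le[OF pbz]])
      also have "\<dots> \<le> \<delta> * (\<delta> * (norm z)\<^sup>2)"
        using le[OF pz] \<delta> by simp
      also have "\<dots> = (\<delta> * norm z)\<^sup>2"
        by (simp add: power2_eq_square)
      finally have "norm (b z) \<le> \<delta> * norm z"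
        by (rule power2_le_imp_le) (use \<delta> in simp)
      also have "\<dots> \<le> \<delta> * norm v"
        using norm_projection_le(2)[OF p(1,2), of v] \<delta> by (simp add: z_def)
      finally have "norm (b z) \<le> \<delta> * norm v" .
      moreover have "e (b v) = e (b z)"
        by (simp add: z_def apply_diff[OF b(1)] apply_diff[OF e] p(3) ep)
      ultimately show ?thesis
        using K(2)[of "b z"] K(1) by (metis mult_le_cancel_left_pos order.trans)
    qed
    have eb: "e (b v) = 0" for v
    proof (rule ccontr)
      assume "e (b v) \<noteq> 0"
      \<comment> \<open>The summand \<open>K\<close> keeps \<open>L\<close> positive even for
        \<open>v = 0\<close>. The choice of \<open>\<delta>\<close> makes the bound half of the norm
        it is meant to bound.\<close>
      define L where "L = K * norm v + K"
      define \<delta> where "\<delta> = norm (e (b v)) / 2 / L"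
      have L: "0 < L" using K(1) by (simp add: L_def add_nonneg_pos)
      then have "0 < \<delta>" using \<open>e (b v) \<noteq> 0\<close> by (simp add: \<delta>_def)
      have "norm (e (b v)) \<le> K * (\<delta> * norm v)" by (rule eb_le) fact
      also have "\<dots> \<le> L * \<delta>" using K(1) \<open>0 < \<delta>\<close> by (simp add: L_def algebra_simps)
      also have "\<dots> = norm (e (b v)) / 2" using L by (simp add: \<delta>_def)
      finally show False using \<open>e (b v) \<noteq> 0\<close> by simp
    qed
    define q where "q = (\<lambda>h. h - b h)"
    have q: "q \<in> A" unfolding q_def by (intro diff_mem id_mem b)
    have q_rinner: "rinner (q h) h = (norm h)\<^sup>2 - rinner (b h) h" for h
      by (simp add: q_def rinner_diff_left rinner_self)
    have q_pos: "op_pos q" using b_le by (simp add: op_pos_iff q_rinner)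
    have "rinner (e (e h)) h \<le> rinner (K\<^sup>2 *\<^sub>R q h) h" for h
    proof -
      \<comment> \<open>From \<open>0 \<le> q \<le> 1\<close> it follows that
        \<open>q\<^sup>2 \<le> q\<close>.\<close>
      have "rinner (q (q h)) (q h) \<le> 1 * (norm (q h))\<^sup>2"
        using op_posD[OF b(2)] by (simp add: q_rinner)
      then have qq: "(norm (q h))\<^sup>2 \<le> rinner (q h) h"
        using norm_positive_le[OF self_adjoint_mem[OF q] q_pos, of h 1] by simp
      have "e h = e (q h)"
        by (simp add: q_def apply_diff[OF e] eb)
      then have "rinner (e (e h)) h = (norm (e (q h)))\<^sup>2"
        by (metis apply_rinner[OF e] rinner_self)
      also have "\<dots> \<le> (K * norm (q h))\<^sup>2"
        by (rule power_mono[OF K(2)]) simp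
      also have "\<dots> \<le> K\<^sup>2 * rinner (q h) h"
        using qq by (simp add: power_mult_distrib mult_left_mono)
      finally show ?thesis by (simp add: rinner_scaleR_left)
    qed
    then have "\<rho> (\<lambda>h. e (e h)) \<le> \<rho> (\<lambda>h. K\<^sup>2 *\<^sub>R q h)"
      by (intro rho_mono square_mem scaleR_mem e q)
    also have "\<dots> \<le> K\<^sup>2 * (t * M)"
      using b_rho by (simp add: rho_scaleR q mult_left_mono flip: q_def)
    finally show ?thesis .
  qed
  have "(\<lambda>n. K\<^sup>2 * (1 / (real n + 1) * M)) \<longlonglongrightarrow> 0"
    by real_asymp
  then have "\<rho> (\<lambda>h. e (e h)) \<le> 0"
    by (rule LIMSEQ_le_const) (intro exI[of _ 0] allI impI rho_le; simp)
  then have "\<rho> (\<lambda>h. e (e h)) = 0"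
    using rho_square_nonneg[OF e] by simp
  then have "(\<lambda>h. e (e h)) = zero_op"
    using faithful square_mem[OF e] square_pos[OF e] by (simp add: faithful_state_def)
  then have "e (e h) = 0"
    by (metis zero_op_def)
  then have "(norm (e h))\<^sup>2 = 0"
    using apply_rinner[OF e, of "e h" h] by (simp add: rinner_self)
  then show ?thesis by simp
qed

lemma jordan_sum_left:
  assumes "b \<in> A"
  shows "jordan (\<lambda>h. \<Sum>i\<in>I. f i h) b = (\<lambda>h. \<Sum>i\<in>I. jordan (f i) b h)"
  by (simp add: jordan_def apply_sum[OF assms] flip: sum.distrib scaleR_right.sum)

text \<open>Pythagoras for the form \<open>\<rho> (jordan a b)\<close>. A new summand enlarges the
  square of the sum by its own square and twice a Jordan product on which \<open>\<rho>\<close>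
  vanishes.\<close>

lemma rho_square_sum_orthogonal:
  fixes y :: "nat \<Rightarrow> 'a \<Rightarrow> 'a"
  assumes y: "\<And>n. y n \<in> A" and orth: "\<And>m n. m \<noteq> n \<Longrightarrow> \<rho> (jordan (y m) (y n)) = 0"
  shows "\<rho> (\<lambda>h. \<Sum>i\<le>k. y i (\<Sum>j\<le>k. y j h)) = (\<Sum>i\<le>k. \<rho> (\<lambda>h. y i (y i h)))"
proof -
  define Y where "Y k = (\<lambda>h. \<Sum>i\<le>k. y i h)" for k
  have Y: "Y k \<in> A" for k
    unfolding Y_def by (intro sum_mem y)
  have "\<rho> (\<lambda>h. Y k (Y k h)) = (\<Sum>i\<le>k. \<rho> (\<lambda>h. y i (y i h)))"
  proof (induction k)
    case (Suc k)
    have "\<rho> (jordan (Y k) (y (Suc k))) = (\<Sum>i\<le>k. \<rho> (jordan (y i) (y (Suc k))))"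
      unfolding Y_def by (simp add: jordan_sum_left y rho_sum jordan_mem)
    then have cross: "\<rho> (jordan (Y k) (y (Suc k))) = 0"
      by (simp add: orth)
    have "(\<lambda>h. Y (Suc k) (Y (Suc k) h)) =
        (\<lambda>h. (Y k (Y k h) + 2 *\<^sub>R jordan (Y k) (y (Suc k)) h) + y (Suc k) (y (Suc k) h))"
    proof
      fix h
      have "Y (Suc k) g = Y k g + y (Suc k) g" for g by (simp add: Y_def)
      then show "Y (Suc k) (Y (Suc k) h) =
          (Y k (Y k h) + 2 *\<^sub>R jordan (Y k) (y (Suc k)) h) + y (Suc k) (y (Suc k) h)"
        by (simp add: jordan_def apply_add[OF Y] apply_add[OF y] algebra_simps)
    qed
    then show ?case
      by (simp add: rho_add rho_scaleR add_mem scaleR_mem square_mem jordan_mem Y y cross Suc)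
  qed (simp add: Y_def)
  then show ?thesis by (simp add: Y_def)
qed

end

section \<open>Bundle limits of uncorrelated sequences\<close>

theorem theorem3p13:
  fixes A :: "('a::complex_hilbert \<Rightarrow> 'a) set"
    and \<rho> :: "('a \<Rightarrow> 'a) \<Rightarrow> real"
    and x :: "nat \<Rightarrow> 'a \<Rightarrow> 'a"
    and x0 :: "'a \<Rightarrow> 'a"
  assumes "JW_algebra A" and "reversible A"
    and "is_state A \<rho>" and "faithful_state A \<rho>" and "normal_state A \<rho>"
    and "\<forall>n. x n \<in> A" and "x0 \<in> A"
    and "\<forall>m n. m \<noteq> n \<longrightarrow> cov \<rho> (x m) (x n) = 0"
    and "bundle_convergent A \<rho> x x0"
    and "summable (\<lambda>n. var \<rho> (x n) * (log 2 (real n + 2))\<^sup>2 / (real n + 1)\<^sup>2)"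
  shows "\<exists>c::complex. x0 = (\<lambda>h. scaleC c h)"
proof -
  interpret jw_state A \<rho>
    by unfold_locales (use assms in auto)
  have x: "x n \<in> A" for n using assms(6) by blast
  note x0 = assms(7)
  obtain D where D: "\<And>m. D m \<in> A" "\<And>m. op_pos (D m)" "summable (\<lambda>m. \<rho> (D m))"
    and D_conv: "\<And>p. p \<in> proj_bundle A D \<Longrightarrow>
      (\<lambda>n. opnorm (p \<circ> (op_diff (x n) x0 \<circ> op_diff (x n) x0) \<circ> p)) \<longlonglongrightarrow> 0"
    using assms(9) unfolding bundle_convergent_def by blast

  \<comment> \<open>Centred operators and the mean-square law of large numbers\<close>
  define y where "y n = (\<lambda>h. x n h - \<rho> (x n) *\<^sub>R h)" for n
  have y: "y n \<in> A" for n
    unfolding y_def by (intro diff_mem scaleR_mem id_mem x)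
  have jordan_y: "\<rho> (jordan (y m) (y n)) = cov \<rho> (x m) (x n)" for m n
  proof -
    have "jordan (y m) (y n) = (\<lambda>h. (jordan (x m) (x n) h - \<rho> (x n) *\<^sub>R x m h) -
        (\<rho> (x m) *\<^sub>R x n h - (\<rho> (x m) * \<rho> (x n)) *\<^sub>R h))"
      by (rule ext) (simp add: jordan_def y_def apply_simps[OF x] algebra_simps
          flip: scaleR_add_left)
    then show ?thesis
      by (simp add: cov_def rho_diff rho_scaleR rho_id diff_mem scaleR_mem jordan_mem x id_mem)
  qed
  define v where "v n = \<rho> (\<lambda>h. y n (y n h))" for n
  have v_nonneg: "0 \<le> v n" for n
    unfolding v_def by (rule rho_square_nonneg[OF y])
  have v_var: "v n = var \<rho> (x n)" for n
  proof -
    have self: "jordan a a = (\<lambda>h. a (a h))" for a :: "'a \<Rightarrow> 'a"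
      by (simp add: jordan_def flip: scaleR_2)
    have "v n = cov \<rho> (x n) (x n)"
      using jordan_y[of n n] by (simp add: v_def self)
    then show ?thesis
      by (simp add: cov_def var_def self comp_def power2_eq_square)
  qed
  have "summable (\<lambda>n. v n / (real n + 1)\<^sup>2)"
  proof (rule summable_comparison_test'[where N = 0])
    show "summable (\<lambda>n. var \<rho> (x n) * (log 2 (real n + 2))\<^sup>2 / (real n + 1)\<^sup>2)"
      by fact
    fix n :: nat
    \<comment> \<open>Indices start at 0, so the logarithm is at least \<open>log 2 2 = 1\<close>
      and the given series dominates the one without it.\<close>
    have "1 \<le> log 2 (real n + 2)" by simp
    then have "v n * 1 \<le> v n * (log 2 (real n + 2))\<^sup>2"
      by (intro mult_left_mono v_nonneg) (simp add: one_le_power)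
    then show "norm (v n / (real n + 1)\<^sup>2) \<le> var \<rho> (x n) * (log 2 (real n + 2))\<^sup>2 / (real n + 1)\<^sup>2"
      using v_nonneg[of n] by (simp add: v_var divide_right_mono)
  qed
  then have mean_lim: "(\<lambda>k. (\<Sum>i\<le>k. v i) / (real k + 1)\<^sup>2) \<longlonglongrightarrow> 0"
    by (rule Kronecker_quadratic[OF v_nonneg])

  define Z where "Z k = (\<lambda>h. (1 / (real k + 1)) *\<^sub>R (\<Sum>i\<le>k. y i h))" for k
  have Z: "Z k \<in> A" for k
    unfolding Z_def by (intro scaleR_mem sum_mem y)
  have "\<rho> (\<lambda>h. Z k (Z k h)) = (\<Sum>i\<le>k. v i) / (real k + 1)\<^sup>2" for k
  proof -
    have mem: "(\<lambda>h. \<Sum>i\<le>k. y i (\<Sum>j\<le>k. y j h)) \<in> A"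
      by (rule square_mem[of "\<lambda>h. \<Sum>i\<le>k. y i h"]) (intro sum_mem y)
    have "(\<lambda>h. Z k (Z k h)) = (\<lambda>h. (1 / (real k + 1)\<^sup>2) *\<^sub>R (\<Sum>i\<le>k. y i (\<Sum>j\<le>k. y j h)))"
      by (rule ext) (simp add: Z_def apply_scaleR[OF y] power2_eq_square flip: scaleR_right.sum)
    then show ?thesis
      using rho_square_sum_orthogonal[of y k] assms(8) y
      by (simp add: rho_scaleR mem jordan_y v_def)
  qed
  then have Z_lim: "(\<lambda>k. \<rho> (\<lambda>h. Z k (Z k h))) \<longlonglongrightarrow> 0"
    using mean_lim by simp
  \<comment> \<open>The geometric bound makes the chosen means summable in the state;
    \<open>N k \<ge> k\<close> lets Cesaro limits pass to the subsequence.\<close>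
  have "\<exists>N\<ge>k. \<rho> (\<lambda>h. Z N (Z N h)) < (1/2) ^ k" for k :: nat
    using order_tendstoD(2)[OF Z_lim, of "(1/2) ^ k"]
    by (auto simp: eventually_sequentially) (meson le_cases)
  then obtain N where N: "\<And>k. k \<le> N k" "\<And>k. \<rho> (\<lambda>h. Z (N k) (Z (N k) h)) < (1/2) ^ k"
    by metis
  define z where "z k = Z (N k)" for k
  have z: "z k \<in> A" for k unfolding z_def by (rule Z)

  \<comment> \<open>\<open>E k\<close> merges the bundle data with the squared means, so that one
    sequence of weights and one family of projections controls both.\<close>
  define E where "E k = (\<lambda>h. D k h + z k (z k h))" for k
  have E: "E k \<in> A" for k
    unfolding E_def by (intro add_mem D square_mem z)
  have E_rinner: "rinner (E k h) h = rinner (D k h) h + (norm (z k h))\<^sup>2" for k h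
    by (simp add: E_def rinner_add_left apply_rinner[OF z] rinner_self)
  have E_pos: "op_pos (E k)" for k
    using op_posD[OF D(2)] by (simp add: op_pos_iff E_rinner)
  have "summable (\<lambda>k. \<rho> (\<lambda>h. z k (z k h)))"
    by (rule summable_comparison_test'[OF summable_geometric[of "1/2"], where N = 0])
      (use N(2) rho_square_nonneg[OF z] in \<open>auto simp: z_def less_imp_le\<close>)
  then have "summable (\<lambda>k. \<rho> (E k))"
    unfolding E_def using summable_add[OF D(3)] by (simp add: rho_add D square_mem z)
  then obtain w where w: "\<And>k. 1 \<le> w k" "filterlim w at_top sequentially"
    "summable (\<lambda>k. w k * \<rho> (E k))"
    using summable_diverging_weights[of "\<lambda>k. \<rho> (E k)"] rho_nonneg[OF E E_pos] by blast
  have w_nonneg: "0 \<le> w k" for k using w(1)[of k] by simp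
  define F where "F k = (\<lambda>h. w k *\<^sub>R E k h)" for k
  have F: "F k \<in> A" for k unfolding F_def by (intro scaleR_mem E)
  have F_rinner: "rinner (F k h) h = w k * (rinner (D k h) h + (norm (z k h))\<^sup>2)" for k h
    by (simp add: F_def rinner_scaleR_left E_rinner)
  have F_pos: "op_pos (F k)" for k
    using op_posD[OF D(2)] w_nonneg by (simp add: op_pos_iff F_rinner)
  have F_sum: "(\<Sum>k\<le>m. \<rho> (F k)) \<le> (\<Sum>k. w k * \<rho> (E k))" for m
    using sum_le_suminf[OF w(3), of "{..m}"] rho_nonneg[OF E E_pos] w_nonneg
    by (simp add: F_def rho_scaleR E)

  define c where "c k = (\<Sum>i\<le>N k. \<rho> (x i)) / (real (N k) + 1)" for k
  \<comment> \<open>The scalar is fixed before any projection appears, hence does not depend on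
    it.\<close>
  obtain \<gamma> where \<gamma>: "\<And>h. (\<lambda>k. c k *\<^sub>R h) \<longlonglongrightarrow> x0 h \<Longrightarrow> x0 h = \<gamma> *\<^sub>R h"
    using scalar_multiplier_of_limits[of x0 c] apply_zero[OF x0] by blast
  define e where "e = (\<lambda>h. x0 h - \<gamma> *\<^sub>R h)"
  have e: "e \<in> A" unfolding e_def by (intro diff_mem scaleR_mem id_mem x0)

  \<comment> \<open>Comparison of Cesaro means on a bounded compression\<close>
  have "e (p u) = 0"
    if p: "p \<in> A" "\<And>h. p (p h) = p h" and C: "0 \<le> C"
      and le: "\<And>m u. (\<Sum>k\<le>m. rinner (F k (p u)) (p u)) \<le> C * (norm (p u))\<^sup>2" for p C u
  \<comment> \<open>A bundle contains only nonzero projections, so \<open>p = 0\<close> is settled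
    separately.\<close>
  proof (cases "p = zero_op")
    case True
    then show ?thesis using apply_zero[OF e] by (simp add: zero_op_def)
  next
    case False
    have "(\<Sum>k\<le>m. w k * rinner (D k (p u)) (p u)) \<le> (\<Sum>k\<le>m. rinner (F k (p u)) (p u))" for m u
      using w_nonneg by (intro sum_mono) (simp add: F_rinner distrib_left)
    then have "(\<Sum>k\<le>m. w k * rinner (D k (p u)) (p u)) \<le> C * (norm (p u))\<^sup>2" for m u
      using le order.trans by blast
    then have "p \<in> proj_bundle A D"
      by (intro proj_bundle_memI[OF D(1,2) p False w(1,2) _ C])
    then have "(\<lambda>n. opnorm (p \<circ> (op_diff (x n) x0 \<circ> op_diff (x n) x0) \<circ> p)) \<longlonglongrightarrow> 0"
      by (rule D_conv)
    then have "(\<lambda>n. op_diff (x n) x0 (p u)) \<longlonglongrightarrow> 0"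
      by (rule compression_tendsto[OF _ p(1), rotated]) (simp add: op_diff_def diff_mem x x0)
    then have "(\<lambda>n. x n (p u)) \<longlonglongrightarrow> x0 (p u)"
      by (simp add: op_diff_def LIM_zero_iff)
    then have "(\<lambda>k. (1 / (real k + 1)) *\<^sub>R (\<Sum>i\<le>k. x i (p u))) \<longlonglongrightarrow> x0 (p u)"
      by (rule Cesaro_mean_tendsto)
    moreover have "filterlim N sequentially sequentially"
      by (rule filterlim_at_top_mono[OF filterlim_ident]) (simp add: N(1))
    ultimately have mean: "(\<lambda>k. (1 / (real (N k) + 1)) *\<^sub>R (\<Sum>i\<le>N k. x i (p u))) \<longlonglongrightarrow> x0 (p u)"
      by (rule filterlim_compose)
    \<comment> \<open>A single summand of a bounded sum of nonnegative terms, divided by its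
      diverging weight, tends to zero.\<close>
    have "(norm (z k (p u)))\<^sup>2 \<le> C * (norm (p u))\<^sup>2 * inverse (w k)" for k
    proof -
      have "w k * (norm (z k (p u)))\<^sup>2 \<le> rinner (F k (p u)) (p u)"
        using w_nonneg op_posD[OF D(2)] by (simp add: F_rinner distrib_left)
      also have "\<dots> \<le> (\<Sum>j\<le>k. rinner (F j (p u)) (p u))"
        by (rule member_le_sum) (simp_all add: op_posD[OF F_pos])
      also have "\<dots> \<le> C * (norm (p u))\<^sup>2" by (rule le)
      finally show ?thesis using w(1)[of k] by (simp add: field_simps)
    qed
    then have "norm ((norm (z k (p u)))\<^sup>2) \<le> C * (norm (p u))\<^sup>2 * inverse (w k)" for k
      by simp
    moreover have "(\<lambda>k. C * (norm (p u))\<^sup>2 * inverse (w k)) \<longlonglongrightarrow> 0"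
      by (rule tendsto_mult_right_zero[OF tendsto_inverse_0_at_top[OF w(2)]])
    ultimately have "(\<lambda>k. (norm (z k (p u)))\<^sup>2) \<longlonglongrightarrow> 0"
      by (rule Lim_null_comparison[OF always_eventually[OF allI]])
    then have "(\<lambda>k. sqrt ((norm (z k (p u)))\<^sup>2)) \<longlonglongrightarrow> sqrt 0"
      by (rule tendsto_real_sqrt)
    then have "(\<lambda>k. z k (p u)) \<longlonglongrightarrow> 0"
      by (simp add: tendsto_norm_zero_iff)
    from tendsto_diff[OF mean this]
    have "(\<lambda>k. (1 / (real (N k) + 1)) *\<^sub>R (\<Sum>i\<le>N k. x i (p u)) - z k (p u)) \<longlonglongrightarrow> x0 (p u)"
      by simp
    \<comment> \<open>The mean of the \<open>x i\<close> minus the mean of the centred operators is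
      the mean of the scalars \<open>\<rho> (x i)\<close>.\<close>
    moreover have "(1 / (real (N k) + 1)) *\<^sub>R (\<Sum>i\<le>N k. x i (p u)) - z k (p u) = c k *\<^sub>R p u" for k
      by (simp add: z_def Z_def y_def c_def sum_subtractf scaleR_diff_right flip: scaleR_sum_left)
    ultimately have "x0 (p u) = \<gamma> *\<^sub>R p u"
      by (intro \<gamma>) simp
    then show ?thesis by (simp add: e_def)
  qed
  then have "e h = 0" for h
    using eq_zero_if_zero_on_compressions[OF F F_pos F_sum e] by blast
  then have "x0 = (\<lambda>h. scaleC (complex_of_real \<gamma>) h)"
    by (intro ext) (simp add: e_def scaleC_of_real)
  then show ?thesis by blast
qed

end
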